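(* Let $\Omega\subset\mathbb{H}_n$ be a bounded $C^{2+\alpha}$ domain for some $0<\alpha<1$, and let $T>0$. Let $J:\mathbb{H}_n\to\mathbb{R}$ satisfy: $J$ is invariant under the action of $U(n)$, $\int_{\mathbb{H}_n}J\,dz\,ds=1$, $J$ is continuous, nonnegative, $J(0,0)>0$, $J$ has compact support, $J(z,-s)=J(z,s)$, and there is a constant $C_1$ with $$\int_{\mathbb{H}_n}J(z,s)x_j^2\,dz\,ds=\int_{\mathbb{H}_n}J(z,s)y_j^2\,dz\,ds=\int_{\mathbb{H}_n}J(z,s)s^2\,dz\,ds=C_1\qquad (1\le j\le n,\ z=x+iy).$$ For $\epsilon>0$ set $J^\epsilon(z,s)=\dfrac{2C_1^{-1}}{\epsilon^{2n+2}}\,J\!\left(\dfrac{z}{\epsilon},\dfrac{s}{\epsilon^2}\right)$. Let $v\in C^{2+\alpha,1+\alpha/2}(\overline\Omega\times[0,T])$ be the solution of $$\begin{cases} v_t(z,s,t)=Lv(z,s,t) & (z,s)\in\Omega,\ t>0,\\ v(z,s,t)=g(z,s,t) & (z,s)\in\partial\Omega,\ t>0,\\ v(z,s,0)=u_0(z,s)& (z,s)\in\Omega,\end{cases}$$ and let $u^\epsilon$ be the solution of $$\begin{cases} u^\epsilon_t(z,s,t)=\dfrac{1}{\epsilon^2}\displaystyle\int_{\mathbb{H}_n}J^\epsilon\bigl(z-\tilde z,\,s-\tilde s-\tfrac12\mathrm{Im}\langle z,\tilde z\rangle\bigr)\bigl[u^\epsilon(\tilde z,\tilde s,t)-u^\epsilon(z,s,t)\bigr]\,d\tilde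 z\,d\tilde s & (z,s)\in\Omega,\ t>0,\\ u^\epsilon(z,s,t)=g(z,s,t) & (z,s)\notin\Omega,\ t>0,\\ u^\epsilon(z,s,0)=u_0(z,s) & (z,s)\in\Omega.\end{cases}$$ Then there exists $C=C(T)$ such that $$\sup_{t\in[0,T]}\|u^\epsilon(\cdot,\cdot,t)-v(\cdot,\cdot,t)\|_{L^\infty(\Omega)}\le C\,\epsilon^\alpha\qquad\text{as }\epsilon\to0.$$
   Context: $\mathbb{H}_n=\mathbb{C}^n\times\mathbb{R}$ is the Heisenberg group with law $(z,s)\cdot(\tilde z,\tilde s)=(z+\tilde z,\ s+\tilde s+\tfrac12\mathrm{Im}\langle z,\tilde z\rangle)$, where $\langle z,w\rangle=\sum_j z_j\overline{w_j}$ is the Hermitian inner product of $\mathbb{C}^n$; Haar measure is Lebesgue measure. The unitary group $U(n)$ acts by $k\cdot(z,s)=(kz,s)$. Writing $z=x+iy$, put $X_j=\partial_{x_j}-\tfrac{y_j}{2}\partial_s$, $Y_j=\partial_{y_j}+\tfrac{x_j}{2}\partial_s$; the Heisenberg Laplacian is $L=\sum_{j=1}^n(X_j^2+Y_j^2)$, i.e. $$L=\sum_{j}\bigl(\partial_{x_j}^2+\partial_{y_j}^2\bigr)+\tfrac14\Bigl(\sum_j(x_j^2+y_j^2)\Bigr)\partial_s^2+\partial_s\sum_j\bigl(x_j\partial_{y_j}-y_j\partial_{x_j}\bigr).$$ $C^{2+\alpha,1+\alpha/2}$ denotes the usual parabolic Hölder class (exponent $2+\alpha$ in the space variables $(x,y,s)$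 and $1+\alpha/2$ in $t$). The function $g$ is the given Dirichlet datum, prescribed outside $\Omega$ in the nonlocal problem and on $\partial\Omega$ in the local one, and $u_0$ is the given initial datum; $u_0$ is not assumed to be invariant under $U(n)$.
   Formalization: Added assumption on the datum: |g(p,t)-g(q,t)| ≤ K|p-q|^α for q on ∂Ω and p outside Ω near q, uniformly in t in (0,T]. Without it the claim fails: g=0 on ∂Ω, g=1 outside the closure, u_0=0 gives v=0 while u^ε stays away from 0 near ∂Ω. *)

theory Defs
  imports "HOL-Analysis.Analysis" "HOL-Probability.Essential_Supremum"
begin

section \<open>The Heisenberg group\<close>

text \<open>
  The index type \<open>'n\<close> has \<open>CARD('n) = n\<close> elements. The norm of this product type is the
  Euclidean norm of \<open>\<real>\<^sup>2\<^sup>n\<^sup>+\<^sup>1\<close>, and \<open>lebesgue\<close> on it is the Haar measure.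
\<close>

type_synonym 'n heis = "(complex ^ 'n) \<times> real"

definition herm :: "complex ^ 'n \<Rightarrow> complex ^ 'n \<Rightarrow> complex" where
  "herm z w = (\<Sum>j\<in>UNIV. z $ j * cnj (w $ j))"

definition heis_mult :: "'n heis \<Rightarrow> 'n heis \<Rightarrow> 'n::finite heis" where
  "heis_mult p q =
     (fst p + fst q, snd p + snd q + 1 / 2 * Im (herm (fst p) (fst q)))"

text \<open>\<open>heis_diff p q\<close> is \<open>p\<close> times the group inverse of \<open>q\<close>; the inverse is \<open>- q\<close>.\<close>

definition heis_diff :: "'n heis \<Rightarrow> 'n heis \<Rightarrow> 'n::finite heis" where
  "heis_diff p q =
     (fst p - fst q, snd p - snd q - 1 / 2 * Im (herm (fst p) (fst q)))"

lemma heis_diff_eq_mult: "heis_diff p q = heis_mult p (- q)"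
  by (simp add: heis_diff_def heis_mult_def herm_def sum_negf)

lemma heis_mult_inverse: "heis_mult p (- p) = 0"
  by (simp add: heis_mult_def herm_def sum_negf zero_prod_def complex_mult_cnj)

definition unitary_matrix :: "complex ^ 'n ^ 'n \<Rightarrow> bool" where
  "unitary_matrix A \<longleftrightarrow> (\<chi> i j. cnj (A $ j $ i)) ** A = mat 1"

section \<open>The Heisenberg Laplacian\<close>

definition dderiv :: "('a::real_normed_vector \<Rightarrow> real) \<Rightarrow> 'a \<Rightarrow> 'a \<Rightarrow> real" where
  "dderiv f h p = deriv (\<lambda>r. f (p + r *\<^sub>R h)) 0"

definition heis_X :: "'n \<Rightarrow> ('n::finite heis \<Rightarrow> real) \<Rightarrow> 'n heis \<Rightarrow> real" where
  "heis_X j f p = dderiv f (axis j 1, 0) p - Im (fst p $ j) / 2 * dderiv f (0, 1) p"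

definition heis_Y :: "'n \<Rightarrow> ('n::finite heis \<Rightarrow> real) \<Rightarrow> 'n heis \<Rightarrow> real" where
  "heis_Y j f p = dderiv f (axis j \<i>, 0) p + Re (fst p $ j) / 2 * dderiv f (0, 1) p"

definition heis_laplacian :: "('n::finite heis \<Rightarrow> real) \<Rightarrow> 'n heis \<Rightarrow> real" where
  "heis_laplacian f p = (\<Sum>j\<in>UNIV. heis_X j (heis_X j f) p + heis_Y j (heis_Y j f) p)"

section \<open>Hoelder classes\<close>

text \<open>Hoelder continuity with exponent \<open>\<beta>\<close> on \<open>S\<close>, uniformly over the index set \<open>I\<close>.\<close>

definition holder_unif ::
    "real \<Rightarrow> 'a::metric_space set \<Rightarrow> 'i set \<Rightarrow> ('i \<Rightarrow> 'a \<Rightarrow> 'b::metric_space) \<Rightarrow> bool" where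
  "holder_unif \<beta> S I f \<longleftrightarrow>
     (\<exists>K. \<forall>i\<in>I. \<forall>x\<in>S. \<forall>y\<in>S. dist (f i x) (f i y) \<le> K * dist x y powr \<beta>)"

definition C2_holder :: "real \<Rightarrow> 'a::euclidean_space set \<Rightarrow> ('a \<Rightarrow> real) \<Rightarrow> bool" where
  "C2_holder \<alpha> S f \<longleftrightarrow>
     (\<exists>(Df :: 'a \<Rightarrow> 'a) (D2f :: 'a \<Rightarrow> 'a \<Rightarrow>\<^sub>L 'a).
        (\<forall>x\<in>S. (f has_derivative (\<lambda>h. Df x \<bullet> h)) (at x)) \<and>
        (\<forall>x\<in>S. (Df has_derivative blinfun_apply (D2f x)) (at x)) \<and>
        holder_unif \<alpha> S {()} (\<lambda>_. D2f))"

text \<open>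
  Bounded \<open>C\<^sup>2\<^sup>+\<^sup>\<alpha>\<close> domains: after a rotation taking the unit vector \<open>\<nu>\<close> to the last
  coordinate direction, the domain is locally the region above a \<open>C\<^sup>2\<^sup>+\<^sup>\<alpha>\<close> graph. The function
  \<open>\<gamma>\<close> of the remaining coordinates is represented as a function on the whole space which
  is constant along \<open>\<nu>\<close>.
\<close>

definition bounded_C2_holder_domain :: "real \<Rightarrow> 'a::euclidean_space set \<Rightarrow> bool" where
  "bounded_C2_holder_domain \<alpha> \<Omega> \<longleftrightarrow>
     open \<Omega> \<and> connected \<Omega> \<and> \<Omega> \<noteq> {} \<and> bounded \<Omega> \<and>
     (\<forall>p\<in>frontier \<Omega>. \<exists>r>0. \<exists>\<nu> \<gamma>. norm \<nu> = 1 \<and>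
        (\<forall>x c. \<gamma> (x + c *\<^sub>R \<nu>) = \<gamma> x) \<and>
        C2_holder \<alpha> (ball p r) \<gamma> \<and>
        \<Omega> \<inter> ball p r = {x \<in> ball p r. x \<bullet> \<nu> > \<gamma> x})"

text \<open>
  The parabolic class \<open>C\<^sup>2\<^sup>+\<^sup>\<alpha>\<^sup>,\<^sup>1\<^sup>+\<^sup>\<alpha>\<^sup>/\<^sup>2\<close> on the closure of \<open>\<Omega>\<close> times \<open>[0,T]\<close>: the derivatives
  \<open>Dv\<close>, \<open>D2v\<close>, \<open>vt\<close> exist over \<open>\<Omega>\<close> and extend continuously to the closure (they are bounded
  there when \<open>\<Omega>\<close> is); \<open>D2v\<close> and \<open>vt\<close> have Hoelder exponent \<open>\<alpha>\<close> in space and \<open>\<alpha>/2\<close> in time,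
  and \<open>Dv\<close> has exponent \<open>(1+\<alpha>)/2\<close> in time.
\<close>

definition parabolic_C2_holder ::
    "real \<Rightarrow> 'a::euclidean_space set \<Rightarrow> real \<Rightarrow> ('a \<Rightarrow> real \<Rightarrow> real) \<Rightarrow> bool" where
  "parabolic_C2_holder \<alpha> \<Omega> T v \<longleftrightarrow>
     (\<exists>(Dv :: 'a \<Rightarrow> real \<Rightarrow> 'a) (D2v :: 'a \<Rightarrow> real \<Rightarrow> 'a \<Rightarrow>\<^sub>L 'a) (vt :: 'a \<Rightarrow> real \<Rightarrow> real).
        (\<forall>t\<in>{0..T}. \<forall>x\<in>\<Omega>.
           ((\<lambda>y. v y t) has_derivative (\<lambda>h. Dv x t \<bullet> h)) (at x) \<and>
           ((\<lambda>y. Dv y t) has_derivative blinfun_apply (D2v x t)) (at x) \<and>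
           (v x has_real_derivative vt x t) (at t within {0..T})) \<and>
        continuous_on (closure \<Omega> \<times> {0..T}) (\<lambda>(x, t). v x t) \<and>
        continuous_on (closure \<Omega> \<times> {0..T}) (\<lambda>(x, t). Dv x t) \<and>
        continuous_on (closure \<Omega> \<times> {0..T}) (\<lambda>(x, t). D2v x t) \<and>
        continuous_on (closure \<Omega> \<times> {0..T}) (\<lambda>(x, t). vt x t) \<and>
        holder_unif \<alpha> (closure \<Omega>) {0..T} (\<lambda>t x. D2v x t) \<and>
        holder_unif \<alpha> (closure \<Omega>) {0..T} (\<lambda>t x. vt x t) \<and>
        holder_unif (\<alpha> / 2) {0..T} (closure \<Omega>) D2v \<and>
        holder_unif (\<alpha> / 2) {0..T} (closure \<Omega>) vt \<and>
        holder_unif ((1 + \<alpha>) / 2) {0..T} (closure \<Omega>) Dv)"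

text \<open>
  The exterior datum has to attain its boundary values with a rate: if \<open>g\<close> jumps across the
  boundary, the local problem does not see its exterior values, and the nonlocal solutions do
  not converge to the local one.
\<close>

definition holder_at_boundary ::
    "real \<Rightarrow> 'a::euclidean_space set \<Rightarrow> real \<Rightarrow> ('a \<Rightarrow> real \<Rightarrow> real) \<Rightarrow> bool" where
  "holder_at_boundary \<alpha> \<Omega> T g \<longleftrightarrow>
     (\<exists>K. \<exists>\<delta>>0. \<forall>t\<in>{0<..T}. \<forall>q\<in>frontier \<Omega>. \<forall>p. p \<notin> \<Omega> \<and> dist p q < \<delta> \<longrightarrow>
        \<bar>g p t - g q t\<bar> \<le> K * dist p q powr \<alpha>)"

section \<open>Kernels and the two problems\<close>

definition admissible_kernel :: "('n::finite heis \<Rightarrow> real) \<Rightarrow> real \<Rightarrow> bool" where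
  "admissible_kernel J C1 \<longleftrightarrow>
     (\<forall>A z s. unitary_matrix A \<longrightarrow> J (A *v z, s) = J (z, s)) \<and>
     (\<integral>p. J p \<partial>lebesgue) = 1 \<and>
     continuous_on UNIV J \<and> (\<forall>p. J p \<ge> 0) \<and> J (0, 0) > 0 \<and>
     compact (closure {p. J p \<noteq> 0}) \<and>
     (\<forall>z s. J (z, - s) = J (z, s)) \<and>
     (\<forall>j. (\<integral>p. J p * (Re (fst p $ j))\<^sup>2 \<partial>lebesgue) = C1) \<and>
     (\<forall>j. (\<integral>p. J p * (Im (fst p $ j))\<^sup>2 \<partial>lebesgue) = C1) \<and>
     (\<integral>p. J p * (snd p)\<^sup>2 \<partial>lebesgue) = C1"

definition rescaled_kernel ::
    "('n::finite heis \<Rightarrow> real) \<Rightarrow> real \<Rightarrow> real \<Rightarrow> 'n heis \<Rightarrow> real" where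
  "rescaled_kernel J C1 \<epsilon> p =
     2 * inverse C1 / \<epsilon> ^ (2 * CARD('n) + 2) * J ((1 / \<epsilon>) *\<^sub>R fst p, snd p / \<epsilon>\<^sup>2)"

definition local_solution ::
    "real \<Rightarrow> 'n::finite heis set \<Rightarrow> real \<Rightarrow> ('n heis \<Rightarrow> real \<Rightarrow> real) \<Rightarrow> ('n heis \<Rightarrow> real) \<Rightarrow>
       ('n heis \<Rightarrow> real \<Rightarrow> real) \<Rightarrow> bool" where
  "local_solution \<alpha> \<Omega> T g u0 v \<longleftrightarrow>
     parabolic_C2_holder \<alpha> \<Omega> T v \<and>
     (\<forall>p\<in>\<Omega>. \<forall>t\<in>{0<..T}.
        (v p has_real_derivative heis_laplacian (\<lambda>q. v q t) p) (at t within {0..T})) \<and>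
     (\<forall>p\<in>frontier \<Omega>. \<forall>t\<in>{0<..T}. v p t = g p t) \<and>
     (\<forall>p\<in>\<Omega>. v p 0 = u0 p)"

text \<open>
  Solutions of the nonlocal problem belong to \<open>C([0,T]; L\<^sup>1(\<Omega>))\<close> (first two conjuncts) and
  satisfy the equation classically in time at every point of \<open>\<Omega>\<close>. Integrability is required
  explicitly because the Bochner integral of a non-integrable function is 0.
\<close>

definition nonlocal_solution ::
    "('n::finite heis \<Rightarrow> real) \<Rightarrow> real \<Rightarrow> real \<Rightarrow> 'n heis set \<Rightarrow> real \<Rightarrow>
       ('n heis \<Rightarrow> real \<Rightarrow> real) \<Rightarrow> ('n heis \<Rightarrow> real) \<Rightarrow> ('n heis \<Rightarrow> real \<Rightarrow> real) \<Rightarrow> bool" where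
  "nonlocal_solution J C1 \<epsilon> \<Omega> T g u0 u \<longleftrightarrow>
     (\<forall>t\<in>{0..T}. integrable (lebesgue_on \<Omega>) (\<lambda>p. u p t)) \<and>
     (\<forall>t\<in>{0..T}. ((\<lambda>\<tau>. \<integral>p. \<bar>u p \<tau> - u p t\<bar> \<partial>lebesgue_on \<Omega>) \<longlongrightarrow> 0) (at t within {0..T})) \<and>
     (\<forall>p\<in>\<Omega>. continuous_on {0..T} (u p)) \<and>
     (\<forall>p\<in>\<Omega>. \<forall>t\<in>{0<..T}.
        integrable lebesgue
          (\<lambda>q. rescaled_kernel J C1 \<epsilon> (heis_diff p q) * (u q t - u p t)) \<and>
        (u p has_real_derivative
           1 / \<epsilon>\<^sup>2 *
             (\<integral>q. rescaled_kernel J C1 \<epsilon> (heis_diff p q) * (u q t - u p t) \<partial>lebesgue))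
          (at t within {0..T})) \<and>
     (\<forall>p. p \<notin> \<Omega> \<longrightarrow> (\<forall>t\<in>{0<..T}. u p t = g p t)) \<and>
     (\<forall>p\<in>\<Omega>. u p 0 = u0 p)"

end

theory Submission
  imports Defs
begin

text \<open>
  Write \<open>w = u - v\<close> and let \<open>T\<^sub>p\<close> be the second order Taylor polynomial of \<open>v(\<cdot>,t)\<close> at
  \<open>p \<in> \<Omega>\<close>. The argument rests on two observations.

  The nonlocal operator is consistent with \<open>L\<close> on quadratic polynomials. In the coordinates
  \<open>q = p + heis_shift \<epsilon> p x\<close>, in which the rescaled kernel becomes a constant
  multiple of \<open>J(x)\<close>, the increment
  \<open>T\<^sub>p(q) - v(p)\<close> is a quadratic polynomial in \<open>x\<close>. By the symmetries of \<open>J\<close> its first moments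
  vanish and its matrix of second moments is \<open>C1\<close> times the identity, so the nonlocal operator
  applied to \<open>T\<^sub>p\<close> has at \<open>p\<close> exactly the value \<open>L v(p) + \<epsilon>\<^sup>2 \<partial>\<^sub>s\<^sup>2 v(p)\<close> (\<open>rescaled_kernel_laplacian\<close>).

  No extension of \<open>v\<close> across \<open>\<partial>\<Omega>\<close> is needed. The kernel sees only points \<open>q\<close> at distance
  \<open>O(\<epsilon>)\<close> from \<open>p\<close>. If \<open>q \<in> \<Omega>\<close>, then \<open>v(q) - T\<^sub>p(q) = O(\<epsilon>\<^sup>2\<^sup>+\<^sup>\<alpha>)\<close>; the segment from \<open>p\<close> to \<open>q\<close>
  may leave \<open>\<Omega>\<close>, but \<open>p\<close> and \<open>q\<close> are joined inside \<open>\<Omega>\<close> by three segments of length \<open>O(|p - q|)\<close>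
  (\<open>bounded_C2_holder_domain_linked\<close>, \<open>holder_taylor_remainder\<close>). If \<open>q \<notin> \<Omega>\<close>, comparison with the
  first boundary point on the segment gives only \<open>g(q) - T\<^sub>p(q) = O(\<epsilon>\<^sup>\<alpha>)\<close>
  (\<open>segment_exit_estimate\<close>). This is too weak for a consistency error, which is divided by
  \<open>\<epsilon>\<^sup>2\<close>, but it suffices as a bound for the exterior values of \<open>w\<close>.

  Consequently \<open>z = \<plusminus> w - B - c t\<close> with suitable \<open>B\<close> and \<open>c\<close> of order \<open>\<epsilon>\<^sup>\<alpha>\<close> is a subsolution of a
  nonlocal equation with zero exterior values. Since \<open>z\<close> is only known to be integrable over
  \<open>\<Omega>\<close>, it need not attain a maximum; instead the Gronwall inequality for the integral of
  the positive part of \<open>z\<close> shows \<open>z \<le> 0\<close> (\<open>nonlocal_comparison\<close>, \<open>nonlocal_error_bound\<close>).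
\<close>

section \<open>Taylor expansion along polygonal paths\<close>

lemma closed_segment_derivative_bound:
  fixes F :: "'a::real_normed_vector \<Rightarrow> 'b::real_normed_vector"
  assumes "\<And>x. x \<in> closed_segment a b \<Longrightarrow> (F has_derivative F' x) (at x)"
    and "\<And>x. x \<in> closed_segment a b \<Longrightarrow> onorm (F' x) \<le> B"
    and "y \<in> closed_segment a b"
  shows "norm (F y - F a) \<le> B * dist a b"
proof -
  have "0 \<le> B"
    using onorm_pos_le[OF has_derivative_bounded_linear[OF assms(1)[OF assms(3)]]] assms(2)[OF assms(3)]
    by linarith
  have "norm (F y - F a) \<le> B * norm (y - a)"
    by (rule differentiable_bound[where S = "closed_segment a b" and f' = F'])
       (use assms in \<open>auto intro: has_derivative_at_withinI\<close>)
  also have "\<dots> \<le> B * dist a b"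
    using segment_bound(1)[OF assms(3)] \<open>0 \<le> B\<close>
    by (intro mult_left_mono) (simp_all add: dist_norm norm_minus_commute)
  finally show ?thesis .
qed

lemma onorm_inner_left_le: "onorm (\<lambda>h. x \<bullet> h) \<le> norm x" for x :: "'a::real_inner"
  by (rule onorm_bound) (simp_all add: Cauchy_Schwarz_ineq2)

lemma second_difference_bound:
  fixes f :: "'a::euclidean_space \<Rightarrow> real"
  assumes Df: "\<And>x. x \<in> ball p \<delta> \<Longrightarrow> (f has_derivative (\<lambda>h. Df x \<bullet> h)) (at x)"
    and D2f: "\<And>x. x \<in> ball p \<delta> \<Longrightarrow> (Df has_derivative blinfun_apply (D2f x)) (at x)"
    and \<omega>: "\<And>x. x \<in> ball p \<delta> \<Longrightarrow> norm (D2f x - D2f p) \<le> \<omega>"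
    and hk: "norm h + norm k < \<delta>"
  shows "\<bar>f (p + h + k) - f (p + k) - f (p + h) + f p - D2f p k \<bullet> h\<bar> \<le> \<omega> * norm h * norm k"
proof -
  have seg: "x \<in> ball p \<delta> \<and> x + c *\<^sub>R k \<in> ball p \<delta>"
    if "x \<in> closed_segment p (p + h)" "0 \<le> c" "c \<le> 1" for x c
  proof -
    have "norm (x - p) \<le> norm h" using segment_bound(1)[OF that(1)] by simp
    moreover have "norm (x + c *\<^sub>R k - p) \<le> norm (x - p) + c * norm k"
      using norm_triangle_ineq[of "x - p" "c *\<^sub>R k"] that by (simp add: algebra_simps)
    moreover have "c * norm k \<le> norm k" using that by (simp add: mult_left_le_one_le)
    ultimately show ?thesis using hk norm_ge_zero[of k]
      by (simp only: mem_ball dist_norm norm_minus_commute[of p]) linarith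
  qed
  have inner: "norm (Df (x + k) - Df x - D2f p k) \<le> \<omega> * norm k" if x: "x \<in> closed_segment p (p + h)" for x
  proof -
    let ?F = "\<lambda>y. Df y - D2f p y"
    have *: "y \<in> ball p \<delta>" if y: "y \<in> closed_segment x (x + k)" for y
    proof -
      obtain c where "0 \<le> c" "c \<le> 1" "y = (1 - c) *\<^sub>R x + c *\<^sub>R (x + k)"
        using y by (auto simp: in_segment)
      then have "y = x + c *\<^sub>R k" by (simp add: algebra_simps)
      then show ?thesis using seg[OF x \<open>0 \<le> c\<close> \<open>c \<le> 1\<close>] by simp
    qed
    have "norm (?F (x + k) - ?F x) \<le> \<omega> * dist x (x + k)"
    proof (rule closed_segment_derivative_bound)
      fix y assume y: "y \<in> closed_segment x (x + k)"
      show "(?F has_derivative blinfun_apply (D2f y - D2f p)) (at y)"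
        unfolding blinfun.diff_left
        by (intro has_derivative_diff D2f *[OF y] bounded_linear_imp_has_derivative blinfun.bounded_linear_right)
      show "onorm (blinfun_apply (D2f y - D2f p)) \<le> \<omega>"
        using \<omega>[OF *[OF y]] by (simp add: norm_blinfun.rep_eq)
    qed auto
    then show ?thesis by (simp add: dist_norm blinfun.add_right algebra_simps)
  qed
  let ?G = "\<lambda>x. f (x + k) - f x - D2f p k \<bullet> x"
  have "norm (?G (p + h) - ?G p) \<le> \<omega> * norm k * dist p (p + h)"
  proof (rule closed_segment_derivative_bound)
    fix x assume x: "x \<in> closed_segment p (p + h)"
    have xk: "x \<in> ball p \<delta>" "x + k \<in> ball p \<delta>" using seg[OF x, of 1] by auto
    have "((\<lambda>y. f (y + k)) has_derivative (\<lambda>h. Df (x + k) \<bullet> h)) (at x)"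
      using has_derivative_compose[of "\<lambda>y. y + k" "\<lambda>h. h" x UNIV f "\<lambda>h. Df (x + k) \<bullet> h"] Df[OF xk(2)]
      by (auto simp: has_derivative_add_const)
    then have "(?G has_derivative (\<lambda>h. Df (x + k) \<bullet> h - Df x \<bullet> h - D2f p k \<bullet> h)) (at x)"
      using Df[OF xk(1)] by (auto intro!: derivative_eq_intros)
    then show "(?G has_derivative (\<lambda>h. (Df (x + k) - Df x - D2f p k) \<bullet> h)) (at x)"
      by (simp add: inner_diff_left)
    show "onorm (\<lambda>h. (Df (x + k) - Df x - D2f p k) \<bullet> h) \<le> \<omega> * norm k"
      using onorm_inner_left_le inner[OF x] by (rule order_trans)
  qed auto
  then show ?thesis by (simp add: dist_norm inner_add_right algebra_simps)
qed

text \<open>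
  The second difference \<open>f(p+h+k) - f(p+k) - f(p+h) + f(p)\<close> is symmetric in \<open>h\<close> and \<open>k\<close>, and up
  to a small error it equals the second derivative evaluated at \<open>k\<close> and \<open>h\<close>.
\<close>

lemma second_derivative_symmetric:
  fixes f :: "'a::euclidean_space \<Rightarrow> real"
  assumes S: "open S" "p \<in> S"
    and Df: "\<And>x. x \<in> S \<Longrightarrow> (f has_derivative (\<lambda>h. Df x \<bullet> h)) (at x)"
    and D2f: "\<And>x. x \<in> S \<Longrightarrow> (Df has_derivative blinfun_apply (D2f x)) (at x)"
    and cont: "continuous_on S D2f"
  shows "D2f p h \<bullet> k = D2f p k \<bullet> h"
proof (cases "h = 0 \<or> k = 0")
  case True then show ?thesis by (auto simp: blinfun.zero_right)
next
  case False
  have "\<bar>D2f p h \<bullet> k - D2f p k \<bullet> h\<bar> \<le> 0 + e" if "e > 0" for e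
  proof -
    define \<omega> where "\<omega> = e / (2 * norm h * norm k)"
    have "\<omega> > 0" using False that by (simp add: \<omega>_def)
    obtain d1 where d1: "d1 > 0" "ball p d1 \<subseteq> S" using S openE by blast
    obtain d2 where d2: "d2 > 0" "\<And>x. x \<in> S \<Longrightarrow> dist x p < d2 \<Longrightarrow> dist (D2f x) (D2f p) < \<omega>"
      using cont S(2) \<open>\<omega> > 0\<close> unfolding continuous_on_iff by meson
    define \<delta> where "\<delta> = min d1 d2"
    define s where "s = \<delta> / 2 / (norm h + norm k)"
    have pos: "0 < norm h + norm k" using False by (simp add: add_pos_pos)
    have "\<delta> > 0" using d1 d2 by (simp add: \<delta>_def)
    then have s: "s > 0" using pos by (simp add: s_def)
    have sum: "s * norm h + s * norm k < \<delta>"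
    proof -
      have "s * (norm h + norm k) = \<delta> / 2"
        unfolding s_def using pos by (intro nonzero_divide_eq_eq[THEN iffD1, symmetric]) auto
      then show ?thesis using \<open>\<delta> > 0\<close> by (simp add: distrib_left)
    qed
    have *: "ball p \<delta> \<subseteq> S" "\<And>x. x \<in> ball p \<delta> \<Longrightarrow> norm (D2f x - D2f p) \<le> \<omega>"
      using d1 d2 by (force simp: \<delta>_def dist_norm norm_minus_commute)+
    have 1: "\<bar>f (p + s *\<^sub>R h + s *\<^sub>R k) - f (p + s *\<^sub>R k) - f (p + s *\<^sub>R h) + f p - D2f p (s *\<^sub>R k) \<bullet> s *\<^sub>R h\<bar>
         \<le> \<omega> * norm (s *\<^sub>R h) * norm (s *\<^sub>R k)"
      by (rule second_difference_bound[where \<delta> = \<delta> and Df = Df])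
         (use Df D2f * sum s in auto)
    have 2: "\<bar>f (p + s *\<^sub>R k + s *\<^sub>R h) - f (p + s *\<^sub>R h) - f (p + s *\<^sub>R k) + f p - D2f p (s *\<^sub>R h) \<bullet> s *\<^sub>R k\<bar>
         \<le> \<omega> * norm (s *\<^sub>R k) * norm (s *\<^sub>R h)"
      by (rule second_difference_bound[where \<delta> = \<delta> and Df = Df])
         (use Df D2f * sum s in \<open>auto simp: add.commute\<close>)
    have "\<bar>D2f p (s *\<^sub>R h) \<bullet> s *\<^sub>R k - D2f p (s *\<^sub>R k) \<bullet> s *\<^sub>R h\<bar> \<le> 2 * (\<omega> * norm (s *\<^sub>R h) * norm (s *\<^sub>R k))"
    proof -
      have eqs: "p + s *\<^sub>R k + s *\<^sub>R h = p + s *\<^sub>R h + s *\<^sub>R k"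
        "\<omega> * norm (s *\<^sub>R k) * norm (s *\<^sub>R h) = \<omega> * norm (s *\<^sub>R h) * norm (s *\<^sub>R k)"
        by (simp_all only: ac_simps)
      show ?thesis using 1 2[unfolded eqs] by linarith
    qed
    also have "D2f p (s *\<^sub>R h) \<bullet> s *\<^sub>R k - D2f p (s *\<^sub>R k) \<bullet> s *\<^sub>R h = s\<^sup>2 * (D2f p h \<bullet> k - D2f p k \<bullet> h)"
      by (simp add: blinfun.scaleR_right power2_eq_square algebra_simps)
    also have "2 * (\<omega> * norm (s *\<^sub>R h) * norm (s *\<^sub>R k)) = s\<^sup>2 * e"
      using False s by (simp add: \<omega>_def power2_eq_square)
    finally show ?thesis using s by (simp add: abs_mult)
  qed
  then show ?thesis using field_le_epsilon[of "\<bar>D2f p h \<bullet> k - D2f p k \<bullet> h\<bar>" 0] by simp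
qed

text \<open>
  Points \<open>p\<close> and \<open>q\<close> are linked in \<open>S\<close> at scale \<open>\<rho>\<close> if a path in \<open>S\<close> of three segments, each of
  length at most \<open>\<rho>\<close>, leads from \<open>p\<close> to \<open>q\<close>.
\<close>

definition linked :: "'a::euclidean_space set \<Rightarrow> real \<Rightarrow> 'a \<Rightarrow> 'a \<Rightarrow> bool" where
  "linked S \<rho> p q \<longleftrightarrow> (\<exists>b c. closed_segment p b \<union> closed_segment b c \<union> closed_segment c q \<subseteq> S \<and>
     dist p b \<le> \<rho> \<and> dist b c \<le> \<rho> \<and> dist c q \<le> \<rho>)"

lemma linked_mono: "linked S \<rho> p q \<Longrightarrow> \<rho> \<le> \<rho>' \<Longrightarrow> linked S \<rho>' p q"
  unfolding linked_def by (meson order_trans)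

lemma polygonal_derivative_bound:
  fixes F :: "'a::real_normed_vector \<Rightarrow> 'b::real_normed_vector"
  defines "P a b c d \<equiv> closed_segment a b \<union> closed_segment b c \<union> closed_segment c d"
  assumes F: "\<And>x. x \<in> P a b c d \<Longrightarrow> (F has_derivative F' x) (at x)"
    and B: "\<And>x. x \<in> P a b c d \<Longrightarrow> onorm (F' x) \<le> B"
    and \<rho>: "dist a b \<le> \<rho>" "dist b c \<le> \<rho>" "dist c d \<le> \<rho>" and y: "y \<in> P a b c d"
  shows "norm (F y - F a) \<le> 3 * (B * \<rho>)"
proof -
  have a: "a \<in> P a b c d" by (simp add: P_def)
  have B0: "0 \<le> B"
    using onorm_pos_le[OF has_derivative_bounded_linear[OF F[OF a]]] B[OF a] by linarith
  have step: "norm (F y - F u) \<le> B * \<rho>"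
    if "closed_segment u v \<subseteq> P a b c d" "dist u v \<le> \<rho>" "y \<in> closed_segment u v" for u v y
  proof -
    have "norm (F y - F u) \<le> B * dist u v"
      by (rule closed_segment_derivative_bound) (use that F B in auto)
    also have "\<dots> \<le> B * \<rho>" using that B0 by (intro mult_left_mono)
    finally show ?thesis .
  qed
  have ab: "norm (F b - F a) \<le> B * \<rho>" by (rule step) (use \<rho> in \<open>auto simp: P_def\<close>)
  have bc: "norm (F c - F b) \<le> B * \<rho>" by (rule step) (use \<rho> in \<open>auto simp: P_def\<close>)
  have "0 \<le> \<rho>" using \<rho>(1) zero_le_dist order_trans by blast
  then have B\<rho>: "0 \<le> B * \<rho>" using B0 by simp
  consider "y \<in> closed_segment a b" | "y \<in> closed_segment b c" | "y \<in> closed_segment c d"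
    using y by (auto simp: P_def)
  then show ?thesis
  proof cases
    case 1
    then have "norm (F y - F a) \<le> B * \<rho>" by (intro step) (use \<rho> in \<open>auto simp: P_def\<close>)
    then show ?thesis using B\<rho> by linarith
  next
    case 2
    then have "norm (F y - F b) \<le> B * \<rho>" by (intro step) (use \<rho> in \<open>auto simp: P_def\<close>)
    then show ?thesis using B\<rho> ab norm_triangle_ineq[of "F y - F b" "F b - F a"] by simp
  next
    case 3
    then have "norm (F y - F c) \<le> B * \<rho>" by (intro step) (use \<rho> in \<open>auto simp: P_def\<close>)
    then show ?thesis
      using ab bc norm_triangle_ineq[of "F y - F c" "F c - F a"] norm_triangle_ineq[of "F c - F b" "F b - F a"]
      by simp
  qed
qed

text \<open>
  The mean value inequality along the path is applied first to the remainder of \<open>Df\<close> and then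
  to the remainder of \<open>f\<close>, whose derivative is the former because \<open>D2f p\<close> is symmetric.
\<close>

lemma taylor_remainder_linked:
  fixes f :: "'a::euclidean_space \<Rightarrow> real"
  assumes S: "open S"
    and Df: "\<And>x. x \<in> S \<Longrightarrow> (f has_derivative (\<lambda>h. Df x \<bullet> h)) (at x)"
    and D2f: "\<And>x. x \<in> S \<Longrightarrow> (Df has_derivative blinfun_apply (D2f x)) (at x)"
    and cont: "continuous_on S D2f"
    and \<omega>: "\<And>x. x \<in> S \<Longrightarrow> dist x p \<le> 3 * \<rho> \<Longrightarrow> norm (D2f x - D2f p) \<le> \<omega>"
    and lk: "linked S \<rho> p q"
  shows "\<bar>f q - (f p + Df p \<bullet> (q - p) + D2f p (q - p) \<bullet> (q - p) / 2)\<bar> \<le> 9 * \<omega> * \<rho>\<^sup>2"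
proof -
  obtain b c where bc: "closed_segment p b \<union> closed_segment b c \<union> closed_segment c q \<subseteq> S"
     (is "?P \<subseteq> S") and \<rho>: "dist p b \<le> \<rho>" "dist b c \<le> \<rho>" "dist c q \<le> \<rho>"
    using lk unfolding linked_def by blast
  have p: "p \<in> S" using bc by auto
  have dist: "dist x p \<le> 3 * \<rho>" if "x \<in> ?P" for x
    using polygonal_derivative_bound[where F = "\<lambda>x. x" and F' = "\<lambda>_ x. x" and B = 1 and y = x, OF _ _ \<rho>] that
    by (simp add: dist_norm onorm_id_le)
  let ?R1 = "\<lambda>x. Df x - Df p - D2f p (x - p)"
  have R1: "norm (?R1 x) \<le> 3 * (\<omega> * \<rho>)" if "x \<in> ?P" for x
  proof -
    have "norm (?R1 x - ?R1 p) \<le> 3 * (\<omega> * \<rho>)"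
    proof (rule polygonal_derivative_bound[OF _ _ \<rho> that])
      fix x assume x: "x \<in> ?P"
      then have xS: "x \<in> S" using bc by blast
      have "(?R1 has_derivative (\<lambda>h. D2f x h - 0 - D2f p (h - 0))) (at x)"
        by (intro has_derivative_diff D2f[OF xS] has_derivative_const
             bounded_linear.has_derivative[OF blinfun.bounded_linear_right] has_derivative_ident)
      then show "(?R1 has_derivative blinfun_apply (D2f x - D2f p)) (at x)"
        by (rule has_derivative_eq_rhs) (simp add: blinfun.diff_left fun_eq_iff)
      show "onorm (blinfun_apply (D2f x - D2f p)) \<le> \<omega>"
        using \<omega>[OF xS dist[OF x]] by (simp add: norm_blinfun.rep_eq)
    qed
    then show ?thesis by simp
  qed
  let ?R = "\<lambda>x. f x - (f p + Df p \<bullet> (x - p) + D2f p (x - p) \<bullet> (x - p) / 2)"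
  have "norm (?R q - ?R p) \<le> 3 * (3 * (\<omega> * \<rho>) * \<rho>)"
  proof (rule polygonal_derivative_bound[OF _ _ \<rho>])
    fix x assume x: "x \<in> ?P"
    then have xS: "x \<in> S" using bc by blast
    have "((\<lambda>x. D2f p (x - p)) has_derivative (\<lambda>h. D2f p (h - 0))) (at x)"
      by (intro bounded_linear.has_derivative[OF blinfun.bounded_linear_right] has_derivative_diff
          has_derivative_ident has_derivative_const)
    then have "(?R has_derivative (\<lambda>h. Df x \<bullet> h - (Df p \<bullet> h + (D2f p (x - p) \<bullet> h + D2f p h \<bullet> (x - p)) / 2))) (at x)"
      using Df[OF xS] by (auto intro!: derivative_eq_intros)
    moreover have "D2f p h \<bullet> (x - p) = D2f p (x - p) \<bullet> h" for h
      by (rule second_derivative_symmetric[OF S p Df D2f cont])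
    ultimately show "(?R has_derivative (\<lambda>h. ?R1 x \<bullet> h)) (at x)"
      by (simp add: inner_diff_left algebra_simps)
    show "onorm (\<lambda>h. ?R1 x \<bullet> h) \<le> 3 * (\<omega> * \<rho>)"
      using onorm_inner_left_le R1[OF x] by (rule order_trans)
  qed simp
  then show ?thesis by (simp add: power2_eq_square)
qed

lemma holder_taylor_remainder:
  fixes f :: "'a::euclidean_space \<Rightarrow> real"
  assumes S: "open S"
    and Df: "\<And>x. x \<in> S \<Longrightarrow> (f has_derivative (\<lambda>h. Df x \<bullet> h)) (at x)"
    and D2f: "\<And>x. x \<in> S \<Longrightarrow> (Df has_derivative blinfun_apply (D2f x)) (at x)"
    and cont: "continuous_on S D2f"
    and hoelder: "\<And>x y. x \<in> S \<Longrightarrow> y \<in> S \<Longrightarrow> norm (D2f x - D2f y) \<le> M * dist x y powr \<alpha>"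
    and "0 \<le> M" "0 \<le> L" "0 < \<alpha>"
    and lk: "linked S (L * dist p q) p q"
  shows "\<bar>f q - (f p + Df p \<bullet> (q - p) + D2f p (q - p) \<bullet> (q - p) / 2)\<bar>
    \<le> 9 * M * (3 * L) powr \<alpha> * L\<^sup>2 * dist p q powr (2 + \<alpha>)"
proof -
  have p: "p \<in> S" using lk unfolding linked_def by auto
  let ?\<rho> = "L * dist p q"
  have "\<bar>f q - (f p + Df p \<bullet> (q - p) + D2f p (q - p) \<bullet> (q - p) / 2)\<bar> \<le> 9 * (M * (3 * ?\<rho>) powr \<alpha>) * ?\<rho>\<^sup>2"
  proof (rule taylor_remainder_linked[OF S Df D2f cont _ lk])
    fix x assume x: "x \<in> S" "dist x p \<le> 3 * ?\<rho>"
    have "norm (D2f x - D2f p) \<le> M * dist x p powr \<alpha>" using hoelder x p by blast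
    also have "\<dots> \<le> M * (3 * ?\<rho>) powr \<alpha>"
      using assms x by (intro mult_left_mono powr_mono2) auto
    finally show "norm (D2f x - D2f p) \<le> M * (3 * ?\<rho>) powr \<alpha>" .
  qed auto
  also have "(3 * ?\<rho>) powr \<alpha> = (3 * L) powr \<alpha> * dist p q powr \<alpha>"
    using assms by (simp add: powr_mult[symmetric] mult.assoc)
  also have "9 * (M * ((3 * L) powr \<alpha> * dist p q powr \<alpha>)) * ?\<rho>\<^sup>2
      = 9 * M * (3 * L) powr \<alpha> * L\<^sup>2 * (dist p q powr \<alpha> * (dist p q)\<^sup>2)"
    by (simp add: power_mult_distrib)
  also have "dist p q powr \<alpha> * (dist p q)\<^sup>2 = dist p q powr (2 + \<alpha>)"
    by (simp add: powr_add mult.commute)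
  finally show ?thesis .
qed

text \<open>
  The point \<open>y\<close> is the first point at which the segment from \<open>p\<close> to \<open>q\<close> leaves \<open>S\<close>, so that the
  mean value theorem applies between \<open>p\<close> and \<open>y\<close>.
\<close>

lemma segment_exit_estimate:
  fixes f :: "'a::euclidean_space \<Rightarrow> real"
  assumes S: "open S" "bounded S"
    and Df: "\<And>x. x \<in> S \<Longrightarrow> (f has_derivative (\<lambda>h. Df x \<bullet> h)) (at x)"
    and cont: "continuous_on (closure S) f"
    and M: "\<And>x. x \<in> S \<Longrightarrow> norm (Df x) \<le> M"
    and p: "p \<in> S" and q: "q \<notin> S"
  obtains y where "y \<in> frontier S" "dist q y \<le> dist p q" "\<bar>f y - f p\<bar> \<le> M * dist p q"
proof -
  have int: "interior S = S" using S by (simp add: interior_open)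
  have "q - p \<noteq> 0" using p q by auto
  then obtain d where d: "0 < d" "p + d *\<^sub>R (q - p) \<in> frontier S"
    and S_before: "\<And>e. 0 \<le> e \<Longrightarrow> e < d \<Longrightarrow> p + e *\<^sub>R (q - p) \<in> S"
    using ray_to_frontier[OF S(2), of p "q - p"] p int by auto
  have "d \<le> 1"
  proof (rule ccontr)
    assume "\<not> d \<le> 1"
    then show False using S_before[of 1] q by simp
  qed
  define y where "y = p + d *\<^sub>R (q - p)"
  let ?g = "\<lambda>e. f (p + e *\<^sub>R (q - p))"
  have cl: "p + e *\<^sub>R (q - p) \<in> closure S" if "e \<in> {0..d}" for e
  proof (cases "e = d")
    case True then show ?thesis using d(2) by (simp add: frontier_def)
  next
    case False then show ?thesis using S_before[of e] that closure_subset by force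
  qed
  obtain \<xi> where \<xi>: "0 < \<xi>" "\<xi> < d"
    and "?g d - ?g 0 = Df (p + \<xi> *\<^sub>R (q - p)) \<bullet> ((d - 0) *\<^sub>R (q - p))"
  proof (rule mvt[OF d(1), where f' = "\<lambda>\<xi> r. Df (p + \<xi> *\<^sub>R (q - p)) \<bullet> (r *\<^sub>R (q - p))"])
    show "continuous_on {0..d} ?g"
      by (rule continuous_on_compose2[OF cont]) (use cl in \<open>auto intro!: continuous_intros\<close>)
    fix e assume e: "0 < e" "e < d"
    show "(?g has_derivative (\<lambda>r. Df (p + e *\<^sub>R (q - p)) \<bullet> (r *\<^sub>R (q - p)))) (at e)"
      by (rule has_derivative_compose[of "\<lambda>e. p + e *\<^sub>R (q - p)" "\<lambda>r. r *\<^sub>R (q - p)"])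
         (use Df[OF S_before[of e]] e in \<open>auto intro!: derivative_eq_intros\<close>)
  qed blast
  then have eq: "f y - f p = Df (p + \<xi> *\<^sub>R (q - p)) \<bullet> (d *\<^sub>R (q - p))"
    by (simp add: y_def)
  have M0: "0 \<le> M" using M[OF p] norm_ge_zero order_trans by blast
  have "\<bar>f y - f p\<bar> \<le> norm (Df (p + \<xi> *\<^sub>R (q - p))) * norm (d *\<^sub>R (q - p))"
    unfolding eq by (rule Cauchy_Schwarz_ineq2)
  also have "\<dots> \<le> M * dist p q"
    using M[OF S_before[of \<xi>]] \<xi> d \<open>d \<le> 1\<close> M0
    by (intro mult_mono) (auto simp: dist_norm norm_minus_commute mult_left_le_one_le)
  finally have est: "\<bar>f y - f p\<bar> \<le> M * dist p q" .
  have "q - y = (1 - d) *\<^sub>R (q - p)" by (simp add: y_def algebra_simps)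
  then have "dist q y \<le> dist p q"
    using d \<open>d \<le> 1\<close> by (simp add: dist_norm norm_minus_commute mult_left_le_one_le)
  with est d(2) show ?thesis using that by (simp add: y_def)
qed

section \<open>Linking nearby points of a bounded domain\<close>

lemma C2_holder_locally_lipschitz:
  fixes \<gamma> :: "'a::euclidean_space \<Rightarrow> real"
  assumes "C2_holder \<alpha> (ball p r) \<gamma>" and "r > 0"
  obtains d B where "0 < d" "d \<le> r" "0 \<le> B"
    "\<And>x y. x \<in> ball p d \<Longrightarrow> y \<in> ball p d \<Longrightarrow> \<bar>\<gamma> x - \<gamma> y\<bar> \<le> B * dist x y"
proof -
  obtain D D2 where D: "\<And>x. x \<in> ball p r \<Longrightarrow> (\<gamma> has_derivative (\<lambda>h. D x \<bullet> h)) (at x)"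
    and D2: "\<And>x. x \<in> ball p r \<Longrightarrow> (D has_derivative blinfun_apply (D2 x)) (at x)"
    using assms unfolding C2_holder_def by blast
  have "isCont D p" using has_derivative_continuous[OF D2] \<open>r > 0\<close> by simp
  then obtain d0 where d0: "d0 > 0" "\<And>x. dist x p < d0 \<Longrightarrow> dist (D x) (D p) < 1"
    unfolding continuous_at_eps_delta by (metis zero_less_one)
  define d where "d = min d0 r"
  define B where "B = norm (D p) + 1"
  have "\<bar>\<gamma> x - \<gamma> y\<bar> \<le> B * dist x y" if "x \<in> ball p d" "y \<in> ball p d" for x y
  proof -
    have "norm (\<gamma> x - \<gamma> y) \<le> B * norm (x - y)"
    proof (rule differentiable_bound[OF convex_ball, where f' = "\<lambda>x h. D x \<bullet> h"])
      fix z assume z: "z \<in> ball p d"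
      show "(\<gamma> has_derivative (\<lambda>h. D z \<bullet> h)) (at z within ball p d)"
        using D z by (auto simp: d_def intro: has_derivative_at_withinI)
      have "dist (D z) (D p) < 1" using d0(2)[of z] z by (simp add: d_def dist_commute[of p])
      then have "norm (D z) \<le> B"
        using norm_triangle_sub[of "D z" "D p"] by (simp add: B_def dist_norm)
      then show "onorm (\<lambda>h. D z \<bullet> h) \<le> B" using onorm_inner_left_le order_trans by blast
    qed (use that in auto)
    then show ?thesis by (simp add: dist_norm)
  qed
  then show ?thesis
    using that[of d B] d0 \<open>r > 0\<close> by (simp add: d_def B_def)
qed

text \<open>
  Above a Lipschitz graph: move both points up by a multiple of their distance, in the direction
  \<open>\<nu>\<close>. The segment between the lifted points then stays above the graph.
\<close>

lemma linked_at_boundary: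
  fixes \<Omega> :: "'a::euclidean_space set"
  assumes r: "r > 0" and \<nu>: "norm \<nu> = 1" and \<gamma>: "\<And>x c. \<gamma> (x + c *\<^sub>R \<nu>) = \<gamma> x"
    and C2: "C2_holder \<alpha> (ball p0 r) \<gamma>"
    and graph: "\<Omega> \<inter> ball p0 r = {x \<in> ball p0 r. x \<bullet> \<nu> > \<gamma> x}"
  shows "\<exists>d>0. \<exists>M. \<forall>p\<in>\<Omega> \<inter> ball p0 d. \<forall>q\<in>\<Omega> \<inter> ball p0 d. linked \<Omega> (M * dist p q) p q"
proof -
  obtain d1 B where d1: "0 < d1" "d1 \<le> r" and "0 \<le> B"
    and B: "\<And>x y. x \<in> ball p0 d1 \<Longrightarrow> y \<in> ball p0 d1 \<Longrightarrow> \<bar>\<gamma> x - \<gamma> y\<bar> \<le> B * dist x y"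
    by (rule C2_holder_locally_lipschitz[OF C2 r]) blast
  define M where "M = B + 1"
  \<comment> \<open>Small enough for points of \<open>ball p0 d\<close>, lifted by at most \<open>2 d M\<close>, to stay in \<open>ball p0 d1\<close>.\<close>
  define d where "d = d1 / (1 + 2 * M)"
  have M: "1 \<le> M" using \<open>0 \<le> B\<close> by (simp add: M_def)
  have d: "0 < d" "d + 2 * d * M = d1" "d \<le> d1"
  proof -
    have "d * (1 + 2 * M) = d1" using M by (simp add: d_def)
    then show "d + 2 * d * M = d1" by (simp add: algebra_simps)
    show "0 < d" using M d1 by (simp add: d_def)
    then have "0 \<le> 2 * d * M" using M by simp
    then show "d \<le> d1" using \<open>d + 2 * d * M = d1\<close> by linarith
  qed
  have "linked \<Omega> (M * dist p q) p q" if p: "p \<in> \<Omega> \<inter> ball p0 d" and q: "q \<in> \<Omega> \<inter> ball p0 d" for p q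
  proof -
    define c where "c = M * dist p q"
    have c0: "0 \<le> c" using M by (simp add: c_def)
    have "dist p q < 2 * d" using p q dist_triangle[of p q p0] by (simp add: dist_commute)
    then have c: "c \<le> 2 * d * M" using M by (simp add: c_def mult.commute)
    have inball: "x + s *\<^sub>R \<nu> \<in> ball p0 d1" if "x \<in> ball p0 d" "0 \<le> s" "s \<le> c" for x s
    proof -
      have "norm (x + s *\<^sub>R \<nu> - p0) \<le> norm (x - p0) + s"
        using norm_triangle_ineq[of "x - p0" "s *\<^sub>R \<nu>"] that \<nu> by (simp add: algebra_simps)
      also have "\<dots> < d + c" using that by (simp add: dist_norm norm_minus_commute)
      finally show ?thesis using c d by (simp add: dist_norm norm_minus_commute)
    qed
    have inner_\<nu>: "\<nu> \<bullet> \<nu> = 1" using \<nu> by (simp add: norm_eq_1)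
    have mem: "x + s *\<^sub>R \<nu> \<in> \<Omega>" if "x \<in> ball p0 d" "0 \<le> s" "s \<le> c" "\<gamma> x < x \<bullet> \<nu> + s" for x s
    proof -
      have "x + s *\<^sub>R \<nu> \<in> {x \<in> ball p0 r. x \<bullet> \<nu> > \<gamma> x}"
        using inball[OF that(1-3)] d1 that(4) by (simp add: \<gamma> inner_add_left inner_\<nu>)
      then show ?thesis using graph by blast
    qed
    have above: "\<gamma> x < x \<bullet> \<nu>" if "x \<in> \<Omega> \<inter> ball p0 d" for x
    proof -
      have "x \<in> \<Omega> \<inter> ball p0 r" using that d1 d by auto
      then show ?thesis unfolding graph by simp
    qed
    have vert: "closed_segment x (x + c *\<^sub>R \<nu>) \<subseteq> \<Omega>" if x: "x \<in> \<Omega> \<inter> ball p0 d" for x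
    proof
      fix y assume "y \<in> closed_segment x (x + c *\<^sub>R \<nu>)"
      then obtain u where u: "0 \<le> u" "u \<le> 1" "y = (1 - u) *\<^sub>R x + u *\<^sub>R (x + c *\<^sub>R \<nu>)"
        by (auto simp: in_segment)
      then have y: "y = x + (u * c) *\<^sub>R \<nu>" by (simp add: algebra_simps)
      have uc: "0 \<le> u * c" "u * c \<le> c" using u c0 by (simp_all add: mult_left_le_one_le)
      show "y \<in> \<Omega>" unfolding y
        by (rule mem) (use x above[OF x] uc in auto)
    qed
    have horiz: "closed_segment (p + c *\<^sub>R \<nu>) (q + c *\<^sub>R \<nu>) \<subseteq> \<Omega>"
    proof
      fix y assume "y \<in> closed_segment (p + c *\<^sub>R \<nu>) (q + c *\<^sub>R \<nu>)"
      then obtain u where u: "0 \<le> u" "u \<le> 1" "y = (1 - u) *\<^sub>R (p + c *\<^sub>R \<nu>) + u *\<^sub>R (q + c *\<^sub>R \<nu>)"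
        by (auto simp: in_segment)
      define x where "x = (1 - u) *\<^sub>R p + u *\<^sub>R q"
      have y: "y = x + c *\<^sub>R \<nu>" using u by (simp add: x_def algebra_simps)
      have xs: "x \<in> closed_segment p q" using u unfolding x_def in_segment by blast
      have xb: "x \<in> ball p0 d"
        using closed_segment_subset[of p "ball p0 d" q] xs p q by auto
      have px: "norm (x - p) \<le> dist p q"
        using segment_bound(1)[OF xs] by (simp add: dist_norm norm_minus_commute)
      have "p \<noteq> q \<or> x = p" using xs by auto
      have "\<gamma> x \<le> \<gamma> p + B * dist x p"
        using B[of x p] xb p d by (simp add: subset_ball[THEN subsetD])
      moreover have "B * dist x p \<le> B * dist p q"
        using px \<open>0 \<le> B\<close> by (intro mult_left_mono) (simp_all add: dist_norm)
      moreover have "p \<bullet> \<nu> - dist p q \<le> x \<bullet> \<nu>"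
        using Cauchy_Schwarz_ineq2[of "x - p" \<nu>] \<nu> px by (simp add: inner_diff_left)
      ultimately have "\<gamma> x < x \<bullet> \<nu> + c"
        using above[OF p] by (simp add: c_def M_def algebra_simps)
      then show "y \<in> \<Omega>" unfolding y by (intro mem xb c0) auto
    qed
    have "linked \<Omega> c p q" unfolding linked_def
    proof (intro exI conjI)
      show "closed_segment p (p + c *\<^sub>R \<nu>) \<union> closed_segment (p + c *\<^sub>R \<nu>) (q + c *\<^sub>R \<nu>)
            \<union> closed_segment (q + c *\<^sub>R \<nu>) q \<subseteq> \<Omega>"
        unfolding closed_segment_commute[of "q + c *\<^sub>R \<nu>" q] using vert[OF p] vert[OF q] horiz by simp
      show "dist (p + c *\<^sub>R \<nu>) (q + c *\<^sub>R \<nu>) \<le> c"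
        using M mult_right_mono[of 1 M "dist p q"] by (simp add: c_def)
    qed (use \<nu> c0 in \<open>simp_all add: dist_norm\<close>)
    then show ?thesis by (simp add: c_def)
  qed
  then show ?thesis using d by blast
qed

text \<open>
  The local statement holds near every point of the compact closure, so a finite subcover and its
  Lebesgue number give constants valid for all pairs of nearby points.
\<close>

lemma bounded_C2_holder_domain_linked:
  fixes \<Omega> :: "'a::euclidean_space set"
  assumes "bounded_C2_holder_domain \<alpha> \<Omega>"
  obtains M \<delta> where "0 < \<delta>" "0 \<le> M"
    "\<And>p q. p \<in> \<Omega> \<Longrightarrow> q \<in> \<Omega> \<Longrightarrow> dist p q < \<delta> \<Longrightarrow> linked \<Omega> (M * dist p q) p q"
proof -
  have op: "open \<Omega>" and bd: "bounded \<Omega>" using assms by (auto simp: bounded_C2_holder_domain_def)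
  have loc: "\<exists>d>0. \<exists>M. \<forall>p\<in>\<Omega> \<inter> ball x d. \<forall>q\<in>\<Omega> \<inter> ball x d. linked \<Omega> (M * dist p q) p q"
    if "x \<in> closure \<Omega>" for x
  proof (cases "x \<in> \<Omega>")
    case True
    then obtain d where d: "d > 0" "ball x d \<subseteq> \<Omega>" using op openE by blast
    have "linked \<Omega> (1 * dist p q) p q" if "p \<in> ball x d" "q \<in> ball x d" for p q
    proof -
      have "closed_segment p q \<subseteq> \<Omega>" using closed_segment_subset[of p "ball x d" q] that d by auto
      then show ?thesis unfolding linked_def
        by (intro exI[of _ p] exI[of _ q]) auto
    qed
    then show ?thesis using d by blast
  next
    case False
    then have "x \<in> frontier \<Omega>" using that op by (simp add: frontier_def interior_open)
    then obtain r \<nu> \<gamma> where "r > 0" "norm \<nu> = 1" "\<forall>x c. \<gamma> (x + c *\<^sub>R \<nu>) = \<gamma> x"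
        "C2_holder \<alpha> (ball x r) \<gamma>" "\<Omega> \<inter> ball x r = {y \<in> ball x r. y \<bullet> \<nu> > \<gamma> y}"
      using assms unfolding bounded_C2_holder_domain_def by meson
    then show ?thesis using linked_at_boundary[of r \<nu> \<gamma> \<alpha> x \<Omega>] by blast
  qed
  then obtain d M where d: "\<And>x. x \<in> closure \<Omega> \<Longrightarrow> d x > 0"
    and M: "\<And>x p q. x \<in> closure \<Omega> \<Longrightarrow> p \<in> \<Omega> \<inter> ball x (d x) \<Longrightarrow> q \<in> \<Omega> \<inter> ball x (d x) \<Longrightarrow>
        linked \<Omega> (M x * dist p q) p q"
    by metis
  have cpt: "compact (closure \<Omega>)" using bd by simp
  have "closure \<Omega> \<subseteq> (\<Union>x\<in>closure \<Omega>. ball x (d x))" using d by fastforce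
  then obtain F where F: "F \<subseteq> closure \<Omega>" "finite F" "closure \<Omega> \<subseteq> (\<Union>x\<in>F. ball x (d x))"
    using compactE_image[OF cpt, of "closure \<Omega>" "\<lambda>x. ball x (d x)"] by blast
  obtain e where e: "0 < e" "\<And>x. x \<in> closure \<Omega> \<Longrightarrow> \<exists>G \<in> (\<lambda>x. ball x (d x)) ` F. ball x e \<subseteq> G"
    using Heine_Borel_lemma[OF cpt, of "(\<lambda>x. ball x (d x)) ` F"] F(3) by auto
  define M' where "M' = (\<Sum>x\<in>F. \<bar>M x\<bar>)"
  have "linked \<Omega> (M' * dist p q) p q" if pq: "p \<in> \<Omega>" "q \<in> \<Omega>" "dist p q < e" for p q
  proof -
    obtain x where x: "x \<in> F" "ball p e \<subseteq> ball x (d x)" 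
      using e(2)[of p] pq closure_subset by blast
    have "p \<in> ball p e" "q \<in> ball p e" using pq e(1) by auto
    then have "p \<in> ball x (d x)" "q \<in> ball x (d x)" using x(2) by blast+
    then have "linked \<Omega> (M x * dist p q) p q" using M x F pq by blast
    moreover have "M x \<le> M'"
      using member_le_sum[of x F "\<lambda>x. \<bar>M x\<bar>"] x F by (simp add: M'_def)
    ultimately show ?thesis by (meson linked_mono mult_right_mono zero_le_dist)
  qed
  moreover have "0 \<le> M'" by (simp add: M'_def sum_nonneg)
  ultimately show ?thesis using that e(1) by blast
qed

section \<open>Moments of an admissible kernel\<close>

lemma lborel_signed_permutation:
  fixes R :: "'a::euclidean_space \<Rightarrow> 'a"
  assumes \<pi>: "bij_betw \<pi> Basis Basis"
    and \<sigma>: "\<And>b. b \<in> Basis \<Longrightarrow> \<sigma> b = 1 \<or> \<sigma> b = - 1"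
    and R: "\<And>x b. b \<in> Basis \<Longrightarrow> R x \<bullet> b = \<sigma> b * (x \<bullet> \<pi> b)"
  shows "distr lborel borel R = lborel"
proof (rule lborel_eqI[symmetric])
  have R_eq: "R = (\<lambda>x. \<Sum>b\<in>Basis. (\<sigma> b * (x \<bullet> \<pi> b)) *\<^sub>R b)"
    by (rule ext, rule euclidean_eqI) (simp add: R)
  have [measurable]: "R \<in> borel \<rightarrow>\<^sub>M borel" unfolding R_eq by measurable
  fix l u :: 'a assume le: "\<And>b. b \<in> Basis \<Longrightarrow> l \<bullet> b \<le> u \<bullet> b"
  define \<pi>' where "\<pi>' = inv_into Basis \<pi>"
  have \<pi>': "\<pi>' (\<pi> b) = b" "\<pi> b \<in> Basis" if "b \<in> Basis" for b
    using that \<pi> by (auto simp: \<pi>'_def bij_betw_def)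
  define l' where "l' = (\<Sum>c\<in>Basis. (if \<sigma> (\<pi>' c) = 1 then l \<bullet> \<pi>' c else - (u \<bullet> \<pi>' c)) *\<^sub>R c)"
  define u' where "u' = (\<Sum>c\<in>Basis. (if \<sigma> (\<pi>' c) = 1 then u \<bullet> \<pi>' c else - (l \<bullet> \<pi>' c)) *\<^sub>R c)"
  have l'u': "l' \<bullet> \<pi> b = (if \<sigma> b = 1 then l \<bullet> b else - (u \<bullet> b))"
     "u' \<bullet> \<pi> b = (if \<sigma> b = 1 then u \<bullet> b else - (l \<bullet> b))" if "b \<in> Basis" for b
    using \<pi>'[OF that] by (simp_all add: l'_def u'_def)
  have all: "(\<forall>c\<in>Basis. P c) \<longleftrightarrow> (\<forall>b\<in>Basis. P (\<pi> b))" for P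
    using ball_simps(9)[of \<pi> Basis P] bij_betw_imp_surj_on[OF \<pi>] by simp
  have "x \<in> R -` box l u \<longleftrightarrow> x \<in> box l' u'" for x
    unfolding vimage_eq mem_box all[of "\<lambda>c. l' \<bullet> c < x \<bullet> c \<and> x \<bullet> c < u' \<bullet> c"]
    using \<sigma> by (intro ball_cong refl) (fastforce simp: R l'u')
  then have "R -` box l u = box l' u'" by (rule set_eqI)
  then have "emeasure (distr lborel borel R) (box l u) = emeasure lborel (box l' u')"
    by (simp add: emeasure_distr)
  also have "\<dots> = (\<Prod>c\<in>Basis. (u' - l') \<bullet> c)"
    using le unfolding emeasure_lborel_box_eq all[of "\<lambda>b. l' \<bullet> b \<le> u' \<bullet> b"] by (simp add: l'u')
  also have "(\<Prod>c\<in>Basis. (u' - l') \<bullet> c) = (\<Prod>b\<in>Basis. (u' - l') \<bullet> \<pi> b)"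
    by (rule prod.reindex_bij_betw[OF \<pi>, symmetric])
  also have "\<dots> = (\<Prod>b\<in>Basis. (u - l) \<bullet> b)"
    by (intro prod.cong refl) (simp add: inner_diff_left l'u')
  finally show "emeasure (distr lborel borel R) (box l u) = (\<Prod>b\<in>Basis. (u - l) \<bullet> b)" .
qed simp

lemma Basis_heis:
  "(Basis :: 'n::finite heis set) = (\<Union>j. {(axis j 1, 0), (axis j \<i>, 0)}) \<union> {(0, 1)}"
  by (auto simp: Basis_prod_def Basis_vec_def Basis_complex_def)

lemma Basis_heisE:
  assumes "b \<in> (Basis :: 'n::finite heis set)"
  obtains j where "b = (axis j 1, 0)" | j where "b = (axis j \<i>, 0)" | "b = (0, 1)"
  using assms unfolding Basis_heis by blast

lemma inner_heis_Basis:
  fixes x :: "'n::finite heis"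
  shows "x \<bullet> (axis j 1, 0) = Re (fst x $ j)" "x \<bullet> (axis j \<i>, 0) = Im (fst x $ j)" "x \<bullet> (0, 1) = snd x"
  by (simp_all add: inner_prod_def inner_axis inner_complex_def)

lemma sum_Basis_heis:
  fixes f :: "'n::finite heis \<Rightarrow> real"
  shows "(\<Sum>b\<in>Basis. f b) = (\<Sum>j\<in>UNIV. f (axis j 1, 0) + f (axis j \<i>, 0)) + f (0, 1)"
proof -
  have "(\<Sum>b\<in>Basis. f b) = (\<Sum>b\<in>(\<Union>j\<in>(UNIV :: 'n set). {(axis j 1, 0), (axis j \<i>, 0)}). f b) + f (0, 1)"
    unfolding Basis_heis by (subst sum.union_disjoint) auto
  also have "(\<Sum>b\<in>(\<Union>j\<in>(UNIV :: 'n set). {(axis j 1, 0), (axis j \<i>, 0)}). f b)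
      = (\<Sum>j\<in>UNIV. \<Sum>b\<in>{(axis j 1, 0), (axis j \<i>, 0)}. f b)"
    by (rule sum.UNION_disjoint) (auto simp: axis_eq_axis)
  also have "\<dots> = (\<Sum>j\<in>UNIV. f (axis j 1, 0) + f (axis j \<i>, 0))"
    by (intro sum.cong refl) (simp add: axis_eq_axis)
  finally show ?thesis .
qed

text \<open>
  Diagonal matrices are the only unitary matrices whose action on the kernel is used: sign
  changes of the complex coordinates, and multiplication by \<open>\<i>\<close>.
\<close>

lemma admissible_kernel_diagonal:
  assumes "admissible_kernel J C1" and d: "\<And>k. cmod (d k) = 1"
  shows "J (\<chi> k. d k * z $ k, s) = J (z, s)"
proof -
  define A where "A = (\<chi> i k. if i = k then d i else 0)"
  have "cnj (d k) * d k = 1" for k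
    using d[of k] by (metis complex_norm_square mult.commute of_real_1 one_power2)
  moreover have "(\<Sum>j\<in>UNIV. cnj (A $ j $ i) * A $ j $ k) = (if i = k then cnj (d i) * d i else 0)" for i k
  proof -
    have "cnj (A $ j $ i) * A $ j $ k = (if j = i then if i = k then cnj (d i) * d i else 0 else 0)" for j
      by (simp add: A_def)
    then show ?thesis by simp
  qed
  ultimately have "unitary_matrix A"
    by (simp add: unitary_matrix_def matrix_matrix_mult_def mat_def vec_eq_iff)
  moreover have "A *v z = (\<chi> k. d k * z $ k)"
  proof -
    have "A $ i $ j * z $ j = (if j = i then d i * z $ i else 0)" for i j
      by (simp add: A_def)
    then show ?thesis by (simp add: matrix_vector_mult_def vec_eq_iff)
  qed
  ultimately show ?thesis using assms(1) by (metis admissible_kernel_def)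
qed

lemma admissible_kernel_measurable:
  fixes J :: "'n::finite heis \<Rightarrow> real"
  assumes "admissible_kernel J C1"
  shows "J \<in> borel_measurable borel"
  using assms by (auto simp: admissible_kernel_def intro: borel_measurable_continuous_onI)

lemma admissible_kernel_integrable:
  fixes J :: "'n::finite heis \<Rightarrow> real"
  assumes J: "admissible_kernel J C1" and f: "continuous_on UNIV f"
  shows "integrable lborel (\<lambda>x. J x * f x)"
proof -
  let ?K = "closure {p. J p \<noteq> 0}"
  have "integrable lborel (\<lambda>x. indicator ?K x *\<^sub>R (J x * f x))"
    using J f by (intro borel_integrable_compact continuous_intros)
      (auto simp: admissible_kernel_def elim: continuous_on_subset)
  moreover have "(\<lambda>x. indicator ?K x *\<^sub>R (J x * f x)) = (\<lambda>x. J x * f x)"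
    using closure_subset[of "{p. J p \<noteq> 0}"] by (force simp: fun_eq_iff split: split_indicator)
  ultimately show ?thesis by (simp only:)
qed

lemma integral_antisymmetric:
  fixes J :: "'a::euclidean_space \<Rightarrow> real"
  assumes R: "distr lborel borel R = lborel" "R \<in> borel \<rightarrow>\<^sub>M borel"
    and [measurable]: "J \<in> borel_measurable borel" "f \<in> borel_measurable borel"
    and J: "\<And>x. J (R x) = J x" and f: "\<And>x. f (R x) = - f x"
  shows "(\<integral>x. J x * f x \<partial>lborel) = 0"
proof -
  note R(2)[measurable]
  have "(\<integral>x. J x * f x \<partial>lborel) = (\<integral>x. J x * f x \<partial>distr lborel borel R)" by (simp only: R)
  also have "\<dots> = (\<integral>x. J (R x) * f (R x) \<partial>lborel)" by (rule integral_distr) measurable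
  also have "\<dots> = - (\<integral>x. J x * f x \<partial>lborel)" by (simp add: J f)
  finally show ?thesis by simp
qed

text \<open>
  Flipping the signs of some complex coordinates, or of the last one, preserves the kernel and
  the measure; the integral of \<open>J\<close> against a function that is odd under the flip vanishes.
\<close>

lemma admissible_kernel_flip:
  fixes J :: "'n::finite heis \<Rightarrow> real" and \<sigma> :: "'n \<Rightarrow> real"
  assumes J: "admissible_kernel J C1"
    and \<sigma>: "\<And>k. \<sigma> k = 1 \<or> \<sigma> k = - 1" and \<tau>: "\<tau> = 1 \<or> \<tau> = - 1"
    and f: "f \<in> borel_measurable borel" "\<And>z s. f (\<chi> k. \<sigma> k *\<^sub>R z $ k, \<tau> * s) = - f (z, s)"
  shows "(\<integral>x. J x * f x \<partial>lborel) = 0"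
proof (rule integral_antisymmetric)
  let ?R = "\<lambda>x :: 'n heis. ((\<chi> k. \<sigma> k *\<^sub>R fst x $ k), \<tau> * snd x)"
  let ?\<sigma> = "\<lambda>b :: 'n heis. if b = (0, 1) then \<tau> else \<sigma> (SOME k. fst b $ k \<noteq> 0)"
  have ax: "(SOME k. axis j c $ k \<noteq> 0) = j" if "c \<noteq> 0" for j :: 'n and c :: complex
    using that by (intro some_equality) (auto simp: axis_def split: if_splits)
  show "?R \<in> borel \<rightarrow>\<^sub>M borel"
    by (intro borel_measurable_continuous_onI continuous_intros continuous_on_vec_lambda)
  show "distr lborel borel ?R = lborel"
  proof (rule lborel_signed_permutation[of "\<lambda>b. b" ?\<sigma>])
    fix x b :: "'n heis" assume "b \<in> Basis"
    then show "?R x \<bullet> b = ?\<sigma> b * (x \<bullet> b)"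
      by (cases rule: Basis_heisE) (simp_all add: inner_heis_Basis ax)
  qed (use \<sigma> \<tau> in \<open>auto simp: bij_betw_def\<close>)
  show "J (?R x) = J x" for x
  proof -
    have "J (?R x) = J (\<chi> k. \<sigma> k *\<^sub>R fst x $ k, snd x)"
      using J \<tau> by (auto simp: admissible_kernel_def)
    also have "\<dots> = J (\<chi> k. of_real (\<sigma> k) * fst x $ k, snd x)" by (simp add: scaleR_conv_of_real)
    also have "\<dots> = J x"
    proof -
      have "cmod (of_real (\<sigma> k)) = 1" for k using \<sigma>[of k] by auto
      then show ?thesis using admissible_kernel_diagonal[OF J, of "\<lambda>k. of_real (\<sigma> k)" "fst x" "snd x"] by simp
    qed
    finally show ?thesis .
  qed
  show "f (?R x) = - f x" for x using f(2)[of "fst x" "snd x"] by simp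
qed (use f admissible_kernel_measurable[OF J] in auto)

lemma admissible_kernel_first_moment:
  fixes J :: "'n::finite heis \<Rightarrow> real"
  assumes J: "admissible_kernel J C1" and b: "b \<in> Basis"
  shows "(\<integral>x. J x * (x \<bullet> b) \<partial>lborel) = 0"
  by (rule admissible_kernel_flip[OF J, where \<sigma> = "\<lambda>_. - 1" and \<tau> = "- 1"])
     (use b in \<open>auto simp: inner_heis_Basis elim!: Basis_heisE\<close>)

text \<open>
  The real and imaginary parts of one coordinate cannot be separated by sign changes, which flip
  both. Multiplication by \<open>\<i>\<close> turns their product \<open>x y\<close> into \<open>- x y\<close>.
\<close>

lemma admissible_kernel_rotation:
  fixes J :: "'n::finite heis \<Rightarrow> real"
  assumes J: "admissible_kernel J C1"
  shows "(\<integral>x. J x * (Re (fst x $ j) * Im (fst x $ j)) \<partial>lborel) = 0"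
proof (rule integral_antisymmetric)
  let ?R = "\<lambda>x :: 'n heis. ((\<chi> k. \<i> * fst x $ k), snd x)"
  let ?\<sigma> = "\<lambda>b :: 'n heis. if \<exists>j. b = (axis j 1, 0) then - 1 else 1 :: real"
  let ?\<pi> = "\<lambda>b :: 'n heis. (\<chi> k. \<i> * cnj (fst b $ k), snd b)"
  have \<pi>: "?\<pi> (axis j 1, 0) = (axis j \<i>, 0)" "?\<pi> (axis j \<i>, 0) = (axis j 1, 0)" "?\<pi> (0, 1) = (0, 1)" for j
    by (auto simp: axis_def vec_eq_iff)
  show "?R \<in> borel \<rightarrow>\<^sub>M borel"
    by (intro borel_measurable_continuous_onI continuous_intros continuous_on_vec_lambda)
  show "distr lborel borel ?R = lborel"
  proof (rule lborel_signed_permutation[of ?\<pi> ?\<sigma>])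
    have "?\<pi> ` Basis \<subseteq> Basis" unfolding Basis_heis using \<pi> by auto
    moreover have "inj_on ?\<pi> Basis"
      by (rule inj_on_inverseI[of _ ?\<pi>]) (auto simp: vec_eq_iff)
    ultimately show "bij_betw ?\<pi> Basis Basis"
      using endo_inj_surj[OF finite_Basis] by (auto simp: bij_betw_def)
    fix x b :: "'n heis" assume "b \<in> Basis"
    then show "?R x \<bullet> b = ?\<sigma> b * (x \<bullet> ?\<pi> b)"
      by (cases rule: Basis_heisE) (auto simp only: \<pi> inner_heis_Basis, auto simp: axis_eq_axis)
  qed auto
  show "J (?R x) = J x" for x
    using admissible_kernel_diagonal[OF J, of "\<lambda>_. \<i>" "fst x" "snd x"] by simp
  show "Re (fst (?R x) $ j) * Im (fst (?R x) $ j) = - (Re (fst x $ j) * Im (fst x $ j))" for x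
    by simp
  show "(\<lambda>x :: 'n heis. Re (fst x $ j) * Im (fst x $ j)) \<in> borel_measurable borel"
    by (intro borel_measurable_continuous_onI continuous_intros)
qed (use admissible_kernel_measurable[OF J] in auto)

text \<open>
  The second moments in all directions of the standard basis, the last one included, are those of
  \<open>C1\<close> times the identity matrix.
\<close>

lemma admissible_kernel_second_moment:
  fixes J :: "'n::finite heis \<Rightarrow> real"
  assumes J: "admissible_kernel J C1" and b: "b \<in> Basis" "c \<in> Basis"
  shows "(\<integral>x. J x * ((x \<bullet> b) * (x \<bullet> c)) \<partial>lborel) = (if b = c then C1 else 0)"
proof -
  note [measurable] = admissible_kernel_measurable[OF J]
  have diag: "(\<integral>x. J x * (x \<bullet> b)\<^sup>2 \<partial>lborel) = C1"
  proof -
    have "(\<integral>x. J x * (x \<bullet> b)\<^sup>2 \<partial>lborel) = (\<integral>x. J x * (x \<bullet> b)\<^sup>2 \<partial>lebesgue)"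
      by (rule integral_completion[symmetric]) measurable
    also have "\<dots> = C1"
      using b(1) J by (cases rule: Basis_heisE) (auto simp: inner_heis_Basis admissible_kernel_def)
    finally show ?thesis .
  qed
  have z: "(\<integral>x. J x * ((x \<bullet> (axis j u, 0)) * (x \<bullet> c)) \<partial>lborel) = 0"
    if c: "c = (0, 1) \<or> (\<exists>k w. c = (axis k w, 0) \<and> k \<noteq> j)" for j u and c :: "'n heis"
    by (rule admissible_kernel_flip[OF J, where \<sigma> = "\<lambda>k. if k = j then - 1 else 1" and \<tau> = 1])
       (use c in \<open>auto simp: inner_prod_def inner_axis intro!: borel_measurable_continuous_onI continuous_intros\<close>)
  have cases: "b = (0, 1) \<or> (\<exists>j. b = (axis j 1, 0) \<or> b = (axis j \<i>, 0))" if "b \<in> Basis" for b :: "'n heis"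
    using that by (cases rule: Basis_heisE) auto
  have sym: "(\<integral>x. J x * ((x \<bullet> b) * (x \<bullet> c)) \<partial>lborel) = (\<integral>x. J x * ((x \<bullet> c) * (x \<bullet> b)) \<partial>lborel)"
    by (simp only: mult.commute[of "x \<bullet> b" for x])
  show ?thesis
  proof (cases "b = c")
    case True then show ?thesis using diag by (simp add: power2_eq_square)
  next
    case bc: False
    have "(\<integral>x. J x * ((x \<bullet> b) * (x \<bullet> c)) \<partial>lborel) = 0"
    proof (cases "b = (0, 1)")
      case True
      then obtain j u where "c = (axis j u, 0)" using cases[OF b(2)] bc by blast
      then show ?thesis using z[of b j u] True sym by simp
    next
      case False
      then obtain j where j: "b = (axis j 1, 0) \<or> b = (axis j \<i>, 0)" using cases[OF b(1)] by blast
      show ?thesis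
      proof (cases "c = (axis j 1, 0) \<or> c = (axis j \<i>, 0)")
        case True
        then have "(\<lambda>x. J x * ((x \<bullet> b) * (x \<bullet> c))) = (\<lambda>x. J x * (Re (fst x $ j) * Im (fst x $ j)))"
          using bc j by (auto simp: inner_heis_Basis)
        then show ?thesis using admissible_kernel_rotation[OF J] by simp
      next
        case False
        then have "c = (0, 1) \<or> (\<exists>k w. c = (axis k w, 0) \<and> k \<noteq> j)"
          using cases[OF b(2)] by blast
        then show ?thesis using j z[of c j] by auto
      qed
    qed
    then show ?thesis using bc by simp
  qed
qed

lemma admissible_kernel_second_moment_pos:
  fixes J :: "'n::finite heis \<Rightarrow> real"
  assumes J: "admissible_kernel J C1"
  shows "0 < C1"
proof -
  let ?f = "\<lambda>x. J x * (snd x)\<^sup>2"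
  have C1: "(\<integral>x. ?f x \<partial>lborel) = C1"
    using admissible_kernel_second_moment[OF J, of "(0, 1)" "(0, 1)"]
    by (simp add: inner_heis_Basis Basis_heis power2_eq_square)
  have "0 \<le> J x" for x using J unfolding admissible_kernel_def by blast
  then have nn: "0 \<le> ?f x" for x by simp
  have cont: "continuous_on UNIV J" using J by (simp add: admissible_kernel_def)
  have int: "integrable lborel ?f"
    by (intro admissible_kernel_integrable[OF J] continuous_intros)
  have "C1 \<noteq> 0"
  proof
    assume "C1 = 0"
    then have "AE x in lborel. ?f x = 0"
      using integral_nonneg_eq_0_iff_AE[OF int] nn C1 by simp
    moreover have "open {x. ?f x \<noteq> 0}"
      by (intro open_Collect_neq continuous_intros cont)
    ultimately have null: "{x. ?f x \<noteq> 0} \<in> null_sets lborel"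
      by (subst (asm) AE_iff_null) auto
    then have "negligible {x. ?f x \<noteq> 0}"
      unfolding negligible_iff_null_sets by (rule null_sets_completionI)
    then have "{x. ?f x \<noteq> 0} = {}"
      using open_not_negligible[OF \<open>open {x. ?f x \<noteq> 0}\<close>] by blast
    then have "?f (0, s) = 0" for s by blast
    then have z: "J (0, s) = 0" if "s \<noteq> 0" for s using that by auto
    \<comment> \<open>The weight \<open>s\<^sup>2\<close> vanishes at the origin, which is therefore reached as a limit.\<close>
    have "((\<lambda>s. J (0, s)) \<longlongrightarrow> J (0, 0)) (at 0)"
      using cont by (intro isContD[where f = "\<lambda>s. J (0, s)"] continuous_on_interior[of UNIV])
        (auto intro!: continuous_intros continuous_on_compose2[OF cont])
    moreover have "((\<lambda>s. J (0, s)) \<longlongrightarrow> 0) (at 0)"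
      by (rule tendsto_eventually) (auto simp: eventually_at_filter z)
    ultimately have "J (0, 0) = 0" using tendsto_unique[of "at (0::real)"] by fastforce
    then show False using J by (simp add: admissible_kernel_def)
  qed
  moreover have "0 \<le> C1" unfolding C1[symmetric] using nn by (rule Bochner_Integration.integral_nonneg)
  ultimately show ?thesis by simp
qed

section \<open>The rescaled kernel in group coordinates\<close>

text \<open>
  The displacement \<open>q - p\<close> of the point \<open>q = x\<^sub>\<epsilon>\<^sup>-\<^sup>1 \<cdot> p\<close>, where \<open>x\<^sub>\<epsilon>\<close> is the parabolic dilation
  \<open>(\<epsilon> a, \<epsilon>\<^sup>2 b)\<close> of \<open>x = (a, b)\<close>; thus \<open>p \<cdot> q\<^sup>-\<^sup>1 = x\<^sub>\<epsilon>\<close>. For fixed \<open>p\<close> it is linear in \<open>x\<close>.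
\<close>

definition heis_shift :: "real \<Rightarrow> 'n heis \<Rightarrow> 'n heis \<Rightarrow> 'n::finite heis" where
  "heis_shift \<epsilon> p x =
     (- (\<epsilon> *\<^sub>R fst x), - (\<epsilon>\<^sup>2 * snd x) - \<epsilon> / 2 * Im (herm (fst x) (fst p)))"

lemma linear_heis_shift: "linear (heis_shift \<epsilon> p)"
proof (rule linearI)
  have herm: "herm (a + b) z = herm a z + herm b z" "herm (c *\<^sub>R a) z = c *\<^sub>R herm a z"
    for a b z :: "complex ^ 'a" and c
    by (simp_all add: herm_def algebra_simps sum.distrib scaleR_sum_right)
  fix x y :: "'a heis" and c
  show "heis_shift \<epsilon> p (x + y) = heis_shift \<epsilon> p x + heis_shift \<epsilon> p y"
    by (simp add: heis_shift_def herm algebra_simps)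
  show "heis_shift \<epsilon> p (c *\<^sub>R x) = c *\<^sub>R heis_shift \<epsilon> p x"
    by (simp add: heis_shift_def herm algebra_simps)
qed

lemma abs_Im_herm_le: "\<bar>Im (herm z w)\<bar> \<le> norm z * norm w"
proof -
  have "Im (herm z w) = z \<bullet> (\<chi> j. \<i> * w $ j)"
    by (simp add: herm_def inner_vec_def inner_complex_def algebra_simps)
  moreover have "norm (\<chi> j. \<i> * w $ j) = norm w" by (simp add: norm_vec_def norm_mult)
  ultimately show ?thesis by (metis Cauchy_Schwarz_ineq2)
qed

lemma norm_heis_shift_le:
  assumes "0 < \<epsilon>" "\<epsilon> \<le> 1"
  shows "norm (heis_shift \<epsilon> p x) \<le> \<epsilon> * ((2 + norm p) * norm x)"
proof -
  have n: "norm (fst x) \<le> norm x" "\<bar>snd x\<bar> \<le> norm x" "norm (fst p) \<le> norm p"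
    using norm_fst_le[of "fst x" "snd x"] norm_snd_le[of "snd x" "fst x"] norm_fst_le[of "fst p" "snd p"] by simp_all
  have "\<epsilon>\<^sup>2 * \<bar>snd x\<bar> \<le> \<epsilon> * norm x"
    using assms n by (intro mult_mono) (auto simp: power2_eq_square mult_left_le)
  moreover have "\<bar>Im (herm (fst x) (fst p))\<bar> \<le> norm p * norm x"
    using abs_Im_herm_le[of "fst x" "fst p"] mult_mono[OF n(1,3)] by (simp add: mult.commute)
  then have "\<epsilon> / 2 * \<bar>Im (herm (fst x) (fst p))\<bar> \<le> \<epsilon> * (norm p * norm x)"
    using assms by (intro mult_mono) auto
  moreover have "\<epsilon> * norm (fst x) \<le> \<epsilon> * norm x" using assms n by simp
  moreover have "norm (heis_shift \<epsilon> p x) \<le> norm (fst (heis_shift \<epsilon> p x)) + norm (snd (heis_shift \<epsilon> p x))"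
    by (metis norm_Pair_le prod.collapse)
  moreover have "norm (fst (heis_shift \<epsilon> p x)) = \<epsilon> * norm (fst x)"
    using assms by (simp add: heis_shift_def)
  moreover have "norm (snd (heis_shift \<epsilon> p x)) \<le> \<epsilon>\<^sup>2 * \<bar>snd x\<bar> + \<epsilon> / 2 * \<bar>Im (herm (fst x) (fst p))\<bar>"
    using assms abs_triangle_ineq4[of "- (\<epsilon>\<^sup>2 * snd x)" "\<epsilon> / 2 * Im (herm (fst x) (fst p))"]
    by (simp add: heis_shift_def abs_mult)
  ultimately show ?thesis by (simp add: algebra_simps)
qed

lemma heis_diff_shift:
  "heis_diff p (p + heis_shift \<epsilon> p x) = (\<epsilon> *\<^sub>R fst x, \<epsilon>\<^sup>2 * snd x)"
proof -
  have 1: "Im (herm z (z - \<epsilon> *\<^sub>R a)) = \<epsilon> * Im (herm a z)" for a z :: "complex ^ 'a"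
    unfolding herm_def Im_sum sum_distrib_left by (intro sum.cong refl) (simp add: algebra_simps)
  show ?thesis by (simp add: heis_diff_def heis_shift_def 1)
qed

lemma heis_diff_eqE:
  fixes p q :: "'n::finite heis"
  assumes "\<epsilon> > 0"
  shows "q = p + heis_shift \<epsilon> p ((1 / \<epsilon>) *\<^sub>R fst (heis_diff p q), snd (heis_diff p q) / \<epsilon>\<^sup>2)"
proof -
  have 1: "Im (herm (z - w) z) = Im (herm z w)" for z w :: "complex ^ 'n"
    unfolding herm_def Im_sum by (intro sum.cong refl) (simp add: algebra_simps)
  have 2: "Im (herm ((1 / \<epsilon>) *\<^sub>R a) z) = Im (herm a z) / \<epsilon>" for a z :: "complex ^ 'n"
    unfolding herm_def Im_sum sum_divide_distrib by (intro sum.cong refl) (simp add: diff_divide_distrib)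
  show ?thesis
    using assms by (simp add: heis_diff_def heis_shift_def prod_eq_iff 1 2)
qed

lemma rescaled_kernel_shift:
  assumes "\<epsilon> > 0"
  shows "rescaled_kernel J C1 \<epsilon> (heis_diff p (p + heis_shift \<epsilon> p x)) =
    2 * inverse C1 / \<epsilon> ^ (2 * CARD('n) + 2) * J (x :: 'n::finite heis)"
  using assms by (simp add: heis_diff_shift rescaled_kernel_def)

lemma continuous_heis_shift [continuous_intros]:
  "continuous_on A f \<Longrightarrow> continuous_on A (\<lambda>x. heis_shift \<epsilon> p (f x))"
  using linear_continuous_on[OF linear_heis_shift[THEN linear_conv_bounded_linear[THEN iffD1]]]
  by (rule continuous_on_compose2) auto

lemma heis_shift_measurable [measurable]:
  "heis_shift \<epsilon> (p :: 'n::finite heis) \<in> borel \<rightarrow>\<^sub>M borel"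
  by (intro borel_measurable_continuous_onI continuous_intros)

lemma nn_integral_lborel_affine:
  fixes t :: "'a::euclidean_space"
  assumes [measurable]: "f \<in> borel_measurable borel" and "c \<noteq> 0"
  shows "(\<integral>\<^sup>+x. f x \<partial>lborel) = ennreal (\<bar>c\<bar> ^ DIM('a)) * (\<integral>\<^sup>+x. f (t + c *\<^sub>R x) \<partial>lborel)"
  by (subst lborel_affine[OF assms(2), of t])
     (simp add: nn_integral_density nn_integral_distr nn_integral_cmult ennreal_power)

text \<open>
  The map is composed of a reflection, a dilation and a shear; its Jacobian has absolute
  value \<open>\<epsilon>\<^sup>2\<^sup>n \<epsilon>\<^sup>2\<close>. By Tonelli's theorem, affine substitutions in \<open>z\<close> and in \<open>s\<close> suffice.
\<close>

lemma lborel_heis_shift: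
  fixes p :: "'n::finite heis"
  assumes \<epsilon>: "\<epsilon> > 0"
  shows "lborel = density (distr lborel borel (\<lambda>x. p + heis_shift \<epsilon> p x)) (\<lambda>_. ennreal (\<epsilon> ^ (2 * CARD('n) + 2)))"
proof (rule measure_eqI)
  fix A assume "A \<in> sets (lborel :: 'n heis measure)"
  then have A [measurable]: "A \<in> sets borel" by simp
  define h where "h a = snd p - \<epsilon> / 2 * Im (herm a (fst p))" for a
  have "continuous_on UNIV h"
    unfolding h_def herm_def by (intro continuous_intros)
  then have [measurable]: "h \<in> borel_measurable borel" by (rule borel_measurable_continuous_onI)
  have Q: "p + heis_shift \<epsilon> p (a, b) = (fst p + (- \<epsilon>) *\<^sub>R a, h a + (- \<epsilon>\<^sup>2) * b)" for a b
    by (simp add: heis_shift_def prod_eq_iff h_def)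
  have "emeasure lborel A = (\<integral>\<^sup>+x. indicator A x \<partial>lborel)" by simp
  also have "\<dots> = (\<integral>\<^sup>+a. \<integral>\<^sup>+b. indicator A (a, b) \<partial>lborel \<partial>lborel)"
    unfolding lborel_prod[symmetric] by (rule lborel.nn_integral_fst[symmetric]) (simp add: lborel_prod)
  also have "\<dots> = ennreal (\<bar>- \<epsilon>\<bar> ^ DIM(complex ^ 'n)) *
      (\<integral>\<^sup>+a. \<integral>\<^sup>+b. indicator A (fst p + (- \<epsilon>) *\<^sub>R a, b) \<partial>lborel \<partial>lborel)"
    by (rule nn_integral_lborel_affine) (use \<epsilon> in auto)
  also have "(\<lambda>a. \<integral>\<^sup>+b. indicator A (fst p + (- \<epsilon>) *\<^sub>R a, b) \<partial>lborel) =
     (\<lambda>a. ennreal \<bar>- \<epsilon>\<^sup>2\<bar> * (\<integral>\<^sup>+b. indicator A (fst p + (- \<epsilon>) *\<^sub>R a, h a + (- \<epsilon>\<^sup>2) * b) \<partial>lborel))"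
    by (intro ext nn_integral_real_affine) (use \<epsilon> in auto)
  also have "(\<integral>\<^sup>+a. ennreal \<bar>- \<epsilon>\<^sup>2\<bar> * (\<integral>\<^sup>+b. indicator A (fst p + (- \<epsilon>) *\<^sub>R a, h a + (- \<epsilon>\<^sup>2) * b) \<partial>lborel) \<partial>lborel) =
     ennreal \<bar>- \<epsilon>\<^sup>2\<bar> * (\<integral>\<^sup>+a. \<integral>\<^sup>+b. indicator A (p + heis_shift \<epsilon> p (a, b)) \<partial>lborel \<partial>lborel)"
    unfolding Q by (rule nn_integral_cmult) measurable
  also have "(\<integral>\<^sup>+a. \<integral>\<^sup>+b. indicator A (p + heis_shift \<epsilon> p (a, b)) \<partial>lborel \<partial>lborel)
     = (\<integral>\<^sup>+x. indicator A (p + heis_shift \<epsilon> p x) \<partial>lborel)"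
    unfolding lborel_prod[symmetric] by (rule lborel.nn_integral_fst) (simp add: lborel_prod)
  also have "ennreal (\<bar>- \<epsilon>\<bar> ^ DIM(complex ^ 'n)) * (ennreal \<bar>- \<epsilon>\<^sup>2\<bar> * (\<integral>\<^sup>+x. indicator A (p + heis_shift \<epsilon> p x) \<partial>lborel))
     = ennreal (\<epsilon> ^ (2 * CARD('n) + 2)) * (\<integral>\<^sup>+x. indicator A (p + heis_shift \<epsilon> p x) \<partial>lborel)"
    using \<epsilon> by (simp add: mult.assoc[symmetric] ennreal_mult[symmetric] power_add mult.commute power2_eq_square)
  also have "\<dots> = emeasure (density (distr lborel borel (\<lambda>x. p + heis_shift \<epsilon> p x)) (\<lambda>_. ennreal (\<epsilon> ^ (2 * CARD('n) + 2)))) A"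
  proof -
    have "(\<integral>\<^sup>+x. indicator A x \<partial>distr lborel borel (\<lambda>x. p + heis_shift \<epsilon> p x)) =
        (\<integral>\<^sup>+x. indicator A (p + heis_shift \<epsilon> p x) \<partial>lborel)"
      by (rule nn_integral_distr) measurable
    then show ?thesis by (simp add: emeasure_density nn_integral_cmult)
  qed
  finally show "emeasure lborel A = \<dots>" .
qed simp

lemma integral_heis_shift:
  fixes p :: "'n::finite heis" and f :: "'n heis \<Rightarrow> real"
  assumes \<epsilon>: "\<epsilon> > 0" and [measurable]: "f \<in> borel_measurable borel"
  shows "(\<integral>q. f q \<partial>lborel) = \<epsilon> ^ (2 * CARD('n) + 2) * (\<integral>x. f (p + heis_shift \<epsilon> p x) \<partial>lborel)"
    and "integrable lborel f \<longleftrightarrow> integrable lborel (\<lambda>x. f (p + heis_shift \<epsilon> p x))"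
   using \<epsilon> by (subst lborel_heis_shift[OF \<epsilon>, of p],
      simp add: integral_density integrable_density integral_distr integrable_distr_eq)+

lemma rescaled_kernel_measurable:
  fixes J :: "'n::finite heis \<Rightarrow> real"
  assumes "admissible_kernel J C1"
  shows "(\<lambda>q. rescaled_kernel J C1 \<epsilon> (heis_diff p q)) \<in> borel_measurable borel"
proof -
  have "continuous_on UNIV (\<lambda>q. ((1 / \<epsilon>) *\<^sub>R fst (heis_diff p q), snd (heis_diff p q) / \<epsilon>\<^sup>2))"
    unfolding heis_diff_def herm_def fst_conv snd_conv divide_inverse by (intro continuous_intros)
  then have [measurable]: "(\<lambda>q. ((1 / \<epsilon>) *\<^sub>R fst (heis_diff p q), snd (heis_diff p q) / \<epsilon>\<^sup>2)) \<in> borel \<rightarrow>\<^sub>M borel"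
    by (rule borel_measurable_continuous_onI)
  note [measurable] = admissible_kernel_measurable[OF assms]
  have "(\<lambda>q. 2 * inverse C1 / \<epsilon> ^ (2 * CARD('n) + 2) *
      J ((1 / \<epsilon>) *\<^sub>R fst (heis_diff p q), snd (heis_diff p q) / \<epsilon>\<^sup>2)) \<in> borel_measurable borel"
    by measurable
  then show ?thesis by (simp only: rescaled_kernel_def)
qed

lemma rescaled_kernel_integral:
  fixes J :: "'n::finite heis \<Rightarrow> real" and p :: "'n heis"
  assumes J: "admissible_kernel J C1" and \<epsilon>: "\<epsilon> > 0" and f: "continuous_on UNIV f"
  defines "K \<equiv> \<lambda>q. rescaled_kernel J C1 \<epsilon> (heis_diff p q)"
  shows "integrable lborel (\<lambda>q. K q * f q)"
    and "(\<integral>q. K q * f q \<partial>lborel) = 2 / C1 * (\<integral>x. J x * f (p + heis_shift \<epsilon> p x) \<partial>lborel)"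
proof -
  have [measurable]: "K \<in> borel_measurable borel"
    unfolding K_def by (rule rescaled_kernel_measurable[OF J])
  have [measurable]: "f \<in> borel_measurable borel" by (rule borel_measurable_continuous_onI[OF f])
  have "integrable lborel (\<lambda>x. J x * f (p + heis_shift \<epsilon> p x))"
    using f by (intro admissible_kernel_integrable[OF J] continuous_on_compose2[OF f] continuous_intros) auto
  then have "integrable lborel (\<lambda>x. 2 * inverse C1 / \<epsilon> ^ (2 * CARD('n) + 2) * (J x * f (p + heis_shift \<epsilon> p x)))"
    by (rule integrable_mult_right)
  then have i: "integrable lborel (\<lambda>x. K (p + heis_shift \<epsilon> p x) * f (p + heis_shift \<epsilon> p x))"
    by (simp only: K_def rescaled_kernel_shift[OF \<epsilon>] mult.assoc)
  then show "integrable lborel (\<lambda>q. K q * f q)"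
    by (subst integral_heis_shift(2)[OF \<epsilon>]) auto
  have "(\<integral>q. K q * f q \<partial>lborel) =
      \<epsilon> ^ (2 * CARD('n) + 2) * (\<integral>x. K (p + heis_shift \<epsilon> p x) * f (p + heis_shift \<epsilon> p x) \<partial>lborel)"
    by (rule integral_heis_shift(1)[OF \<epsilon>]) measurable
  also have "(\<integral>x. K (p + heis_shift \<epsilon> p x) * f (p + heis_shift \<epsilon> p x) \<partial>lborel) =
      (\<integral>x. 2 * inverse C1 / \<epsilon> ^ (2 * CARD('n) + 2) * (J x * f (p + heis_shift \<epsilon> p x)) \<partial>lborel)"
    by (simp only: K_def rescaled_kernel_shift[OF \<epsilon>] mult.assoc)
  also have "\<dots> = 2 * inverse C1 / \<epsilon> ^ (2 * CARD('n) + 2) * (\<integral>x. J x * f (p + heis_shift \<epsilon> p x) \<partial>lborel)"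
    by (rule integral_mult_right_zero)
  also have "P * (2 * inverse C1 / P * I) = 2 / C1 * I" if "P \<noteq> 0" for P I :: real
    using that by (simp add: divide_inverse)
  finally show "(\<integral>q. K q * f q \<partial>lborel) = 2 / C1 * (\<integral>x. J x * f (p + heis_shift \<epsilon> p x) \<partial>lborel)"
    using \<epsilon> by simp
qed

lemma rescaled_kernel_mass:
  fixes J :: "'n::finite heis \<Rightarrow> real"
  assumes J: "admissible_kernel J C1" and \<epsilon>: "\<epsilon> > 0"
  shows "(\<integral>q. rescaled_kernel J C1 \<epsilon> (heis_diff p q) \<partial>lborel) = 2 / C1"
proof -
  have "(\<integral>x. J x \<partial>lborel) = 1"
    using J integral_completion[of J lborel] admissible_kernel_measurable[OF J]
    by (simp add: admissible_kernel_def)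
  then show ?thesis using rescaled_kernel_integral(2)[OF J \<epsilon>, of "\<lambda>_. 1" p] by simp
qed

lemma rescaled_kernel_bounded:
  fixes J :: "'n::finite heis \<Rightarrow> real"
  assumes J: "admissible_kernel J C1" and \<epsilon>: "\<epsilon> > 0"
  obtains \<kappa> where "0 \<le> \<kappa>" "\<And>w. 0 \<le> rescaled_kernel J C1 \<epsilon> w" "\<And>w. rescaled_kernel J C1 \<epsilon> w \<le> \<kappa>"
proof -
  have J0: "0 \<le> J x" for x using J unfolding admissible_kernel_def by blast
  have C1: "0 < C1" by (rule admissible_kernel_second_moment_pos[OF J])
  have "compact (closure {p. J p \<noteq> 0})" "continuous_on (closure {p. J p \<noteq> 0}) J"
    using J by (auto simp: admissible_kernel_def intro: continuous_on_subset)
  then have "bounded (J ` closure {p. J p \<noteq> 0})"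
    using compact_continuous_image compact_imp_bounded by blast
  then obtain B where B: "\<And>x. x \<in> closure {p. J p \<noteq> 0} \<Longrightarrow> norm (J x) \<le> B"
    unfolding bounded_iff by blast
  have B': "J x \<le> max B 0" for x
    using B[of x] closure_subset[of "{p. J p \<noteq> 0}"] by (cases "J x = 0") (auto simp: max_def)
  let ?c = "2 * inverse C1 / \<epsilon> ^ (2 * CARD('n) + 2)"
  have c: "0 \<le> ?c" using C1 \<epsilon> by simp
  show ?thesis
  proof (rule that[of "?c * max B 0"])
    show "0 \<le> ?c * max B 0" by (rule mult_nonneg_nonneg[OF c]) simp
    show "0 \<le> rescaled_kernel J C1 \<epsilon> w" for w
      unfolding rescaled_kernel_def using c J0 by (rule mult_nonneg_nonneg)
    show "rescaled_kernel J C1 \<epsilon> w \<le> ?c * max B 0" for w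
      unfolding rescaled_kernel_def using B' c by (rule mult_left_mono)
  qed
qed

lemma rescaled_kernel_support:
  fixes J :: "'n::finite heis \<Rightarrow> real"
  assumes J: "admissible_kernel J C1" and \<Omega>: "bounded \<Omega>"
  obtains R where "0 < R" "\<And>\<epsilon> p q. 0 < \<epsilon> \<Longrightarrow> \<epsilon> \<le> 1 \<Longrightarrow> p \<in> \<Omega> \<Longrightarrow>
     rescaled_kernel J C1 \<epsilon> (heis_diff p q) \<noteq> 0 \<Longrightarrow> dist p q \<le> \<epsilon> * R"
proof -
  have "bounded {p. J p \<noteq> 0}"
    using J closure_subset bounded_subset compact_imp_bounded unfolding admissible_kernel_def by metis
  then obtain \<rho> where \<rho>: "0 < \<rho>" "\<And>x. J x \<noteq> 0 \<Longrightarrow> norm x \<le> \<rho>" unfolding bounded_pos by blast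
  obtain P where P: "0 < P" "\<And>x. x \<in> \<Omega> \<Longrightarrow> norm x \<le> P" using \<Omega> unfolding bounded_pos by blast
  have "dist p q \<le> \<epsilon> * ((2 + P) * \<rho>)"
    if \<epsilon>: "0 < \<epsilon>" "\<epsilon> \<le> 1" and p: "p \<in> \<Omega>" and nz: "rescaled_kernel J C1 \<epsilon> (heis_diff p q) \<noteq> 0" for \<epsilon> p q
  proof -
    let ?x = "((1 / \<epsilon>) *\<^sub>R fst (heis_diff p q), snd (heis_diff p q) / \<epsilon>\<^sup>2)"
    have "J ?x \<noteq> 0" using nz by (auto simp: rescaled_kernel_def)
    then have x: "norm ?x \<le> \<rho>" by (rule \<rho>(2))
    have "dist p q = norm (heis_shift \<epsilon> p ?x)"
      by (subst heis_diff_eqE[OF \<epsilon>(1), of q p]) (simp add: dist_norm)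
    also have "\<dots> \<le> \<epsilon> * ((2 + norm p) * norm ?x)" by (rule norm_heis_shift_le[OF \<epsilon>])
    also have "\<dots> \<le> \<epsilon> * ((2 + P) * \<rho>)"
      using \<epsilon> P p x \<rho> by (intro mult_left_mono mult_mono add_mono) (auto simp: add_nonneg_nonneg)
    finally show ?thesis .
  qed
  then show ?thesis using that[of "(2 + P) * \<rho>"] P \<rho> by simp
qed

section \<open>Consistency with the Heisenberg Laplacian\<close>

text \<open>
  Linear terms integrate to zero, and the second moments turn a quadratic form into its trace in
  the basis of group coordinates.
\<close>

lemma rescaled_kernel_quadratic:
  fixes J :: "'n::finite heis \<Rightarrow> real" and D p :: "'n heis" and B :: "'n heis \<Rightarrow>\<^sub>L 'n heis"
  assumes J: "admissible_kernel J C1" and C1: "C1 \<noteq> 0" and \<epsilon>: "\<epsilon> > 0"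
  shows "(\<integral>q. rescaled_kernel J C1 \<epsilon> (heis_diff p q) * (D \<bullet> (q - p) + B (q - p) \<bullet> (q - p) / 2) \<partial>lborel)
    = (\<Sum>b\<in>Basis. B (heis_shift \<epsilon> p b) \<bullet> heis_shift \<epsilon> p b)"
proof -
  let ?\<Lambda> = "heis_shift \<epsilon> p"
  have int: "integrable lborel (\<lambda>x. J x * f x)" if "continuous_on UNIV f" for f
    by (rule admissible_kernel_integrable[OF J that])
  have expand: "?\<Lambda> x = (\<Sum>b\<in>Basis. (x \<bullet> b) *\<^sub>R ?\<Lambda> b)" for x
    by (subst euclidean_representation[of x, symmetric])
       (simp only: linear_sum[OF linear_heis_shift] linear_scale[OF linear_heis_shift])
  have lin: "D \<bullet> ?\<Lambda> x = (\<Sum>b\<in>Basis. (D \<bullet> ?\<Lambda> b) * (x \<bullet> b))" for x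
    by (subst expand) (simp add: inner_sum_right mult.commute)
  have quad: "B (?\<Lambda> x) \<bullet> ?\<Lambda> x =
      (\<Sum>b\<in>Basis. \<Sum>c\<in>Basis. (B (?\<Lambda> c) \<bullet> ?\<Lambda> b) * ((x \<bullet> b) * (x \<bullet> c)))" for x
    by (subst (1 2) expand)
       (simp add: blinfun.sum_right blinfun.scaleR_right inner_sum_left inner_sum_right sum_distrib_left mult_ac)
  have "(\<integral>q. rescaled_kernel J C1 \<epsilon> (heis_diff p q) * (D \<bullet> (q - p) + B (q - p) \<bullet> (q - p) / 2) \<partial>lborel)
      = 2 / C1 * (\<integral>x. J x * (D \<bullet> ?\<Lambda> x + B (?\<Lambda> x) \<bullet> ?\<Lambda> x / 2) \<partial>lborel)"
  proof -
    have "continuous_on UNIV (\<lambda>q. D \<bullet> (q - p) + B (q - p) \<bullet> (q - p) / 2)"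
      by (intro continuous_intros) auto
    from rescaled_kernel_integral(2)[OF J \<epsilon> this, of p] show ?thesis
      by (simp only: add_diff_cancel_left')
  qed
  also have "(\<integral>x. J x * (D \<bullet> ?\<Lambda> x + B (?\<Lambda> x) \<bullet> ?\<Lambda> x / 2) \<partial>lborel)
      = (\<integral>x. (\<Sum>b\<in>Basis. (D \<bullet> ?\<Lambda> b) * (J x * (x \<bullet> b))) +
          (\<Sum>b\<in>Basis. \<Sum>c\<in>Basis. (B (?\<Lambda> c) \<bullet> ?\<Lambda> b) / 2 * (J x * ((x \<bullet> b) * (x \<bullet> c)))) \<partial>lborel)"
  proof (intro Bochner_Integration.integral_cong refl)
    fix x
    show "J x * (D \<bullet> ?\<Lambda> x + B (?\<Lambda> x) \<bullet> ?\<Lambda> x / 2) = (\<Sum>b\<in>Basis. (D \<bullet> ?\<Lambda> b) * (J x * (x \<bullet> b))) +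
          (\<Sum>b\<in>Basis. \<Sum>c\<in>Basis. (B (?\<Lambda> c) \<bullet> ?\<Lambda> b) / 2 * (J x * ((x \<bullet> b) * (x \<bullet> c))))"
      unfolding lin[of x] quad[of x] by (simp add: distrib_left sum_distrib_left sum_divide_distrib mult_ac)
  qed
  also have "\<dots> = (\<Sum>b\<in>Basis. (D \<bullet> ?\<Lambda> b) * (\<integral>x. J x * (x \<bullet> b) \<partial>lborel)) +
      (\<Sum>b\<in>Basis. \<Sum>c\<in>Basis. (B (?\<Lambda> c) \<bullet> ?\<Lambda> b) / 2 * (\<integral>x. J x * ((x \<bullet> b) * (x \<bullet> c)) \<partial>lborel))"
  proof -
    have int1: "integrable lborel (\<lambda>x. d * (J x * (x \<bullet> b)))"
      and int2: "integrable lborel (\<lambda>x. d * (J x * ((x \<bullet> b) * (x \<bullet> c))))" for b c d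
      by (intro integrable_mult_right int continuous_intros)+
    show ?thesis
      by (subst Bochner_Integration.integral_add)
         (simp_all only: Bochner_Integration.integrable_sum int1 int2 Bochner_Integration.integral_sum integral_mult_right_zero)
  qed
  also have "\<dots> = (\<Sum>b\<in>Basis. \<Sum>c\<in>Basis. (B (?\<Lambda> c) \<bullet> ?\<Lambda> b) / 2 * (if b = c then C1 else 0))"
    by (simp add: admissible_kernel_first_moment[OF J] admissible_kernel_second_moment[OF J])
  also have "\<dots> = C1 / 2 * (\<Sum>b\<in>Basis. B (?\<Lambda> b) \<bullet> ?\<Lambda> b)"
  proof -
    have "(\<Sum>c\<in>Basis. (B (?\<Lambda> c) \<bullet> ?\<Lambda> b) / 2 * (if b = c then C1 else 0)) = C1 / 2 * (B (?\<Lambda> b) \<bullet> ?\<Lambda> b)"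
      if "b \<in> Basis" for b
    proof -
      have "(B (?\<Lambda> c) \<bullet> ?\<Lambda> b) / 2 * (if b = c then C1 else 0)
          = (if b = c then C1 / 2 * (B (?\<Lambda> b) \<bullet> ?\<Lambda> b) else 0)" for c by simp
      then show ?thesis using that by simp
    qed
    then show ?thesis unfolding sum_distrib_left by (rule sum.cong[OF refl])
  qed
  finally show ?thesis using C1 by simp
qed

lemma dderiv_eqI: "(f has_derivative f') (at p) \<Longrightarrow> dderiv f h p = f' h"
proof -
  assume f: "(f has_derivative f') (at p)"
  have "((\<lambda>r. f (p + r *\<^sub>R h)) has_derivative (\<lambda>r. f' (r *\<^sub>R h))) (at 0)"
    by (rule has_derivative_compose[of "\<lambda>r. p + r *\<^sub>R h"]) (use f in \<open>auto intro!: derivative_eq_intros\<close>)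
  then have "((\<lambda>r. f (p + r *\<^sub>R h)) has_real_derivative f' h) (at 0)"
    by (rule has_derivative_imp_has_field_derivative)
       (simp add: linear_scale[OF has_derivative_linear[OF f]])
  then show ?thesis unfolding dderiv_def by (rule DERIV_imp_deriv)
qed

lemma dderiv_cong:
  assumes "\<forall>\<^sub>F x in nhds p. f x = g x"
  shows "dderiv f h p = dderiv g h p"
proof -
  have "((\<lambda>r. p + r *\<^sub>R h) \<longlongrightarrow> p + 0 *\<^sub>R h) (nhds 0)"
    by (intro tendsto_intros filterlim_ident)
  then have "\<forall>\<^sub>F r in nhds 0. f (p + r *\<^sub>R h) = g (p + r *\<^sub>R h)"
    using eventually_compose_filterlim[OF assms, of "\<lambda>r. p + r *\<^sub>R h" "nhds 0"] by simp
  then show ?thesis unfolding dderiv_def by (rule deriv_cong_ev) simp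
qed

text \<open>
  The coefficient of \<open>X\<^sub>j\<close> depends only on \<open>y\<^sub>j\<close>, and \<open>X\<^sub>j\<close> does not differentiate in \<open>y\<^sub>j\<close>; likewise for
  \<open>Y\<^sub>j\<close>. Hence the squares of these fields have no first order part.
\<close>

lemma heis_laplacian_eq:
  fixes f :: "'n::finite heis \<Rightarrow> real"
  assumes S: "open S" "p \<in> S"
    and Df: "\<And>x. x \<in> S \<Longrightarrow> (f has_derivative (\<lambda>h. Df x \<bullet> h)) (at x)"
    and D2f: "(Df has_derivative blinfun_apply (D2f p)) (at p)"
  defines "X j \<equiv> (axis j 1, - Im (fst p $ j) / 2)" and "Y j \<equiv> (axis j \<i>, Re (fst p $ j) / 2)"
  shows "heis_laplacian f p = (\<Sum>j\<in>UNIV. D2f p (X j) \<bullet> X j + D2f p (Y j) \<bullet> Y j)"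
proof -
  have near: "\<forall>\<^sub>F x in nhds p. x \<in> S" using S by (rule eventually_nhds_in_open)
  have second: "dderiv (\<lambda>x. Df x \<bullet> k - l x * (Df x \<bullet> m)) h p
      = D2f p h \<bullet> k - (l p * (D2f p h \<bullet> m) + l' h * (Df p \<bullet> m))"
    if "(l has_derivative l') (at p)" for k l l' m h
    by (rule dderiv_eqI) (use that D2f in \<open>auto intro!: derivative_eq_intros\<close>)
  have square: "D2f p (a - l *\<^sub>R m) \<bullet> (a - l *\<^sub>R m) =
      D2f p a \<bullet> a - l * (D2f p a \<bullet> m) - l * (D2f p m \<bullet> a - l * (D2f p m \<bullet> m))" for a m l
    by (simp add: blinfun.diff_right blinfun.scaleR_right inner_diff_left inner_diff_right algebra_simps)
  have X: "heis_X j (heis_X j f) p = D2f p (X j) \<bullet> X j" for j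
  proof -
    let ?l = "\<lambda>x :: 'n heis. Im (fst x $ j) / 2"
    have l: "(?l has_derivative ?l) (at p)"
      by (intro bounded_linear_imp_has_derivative linear_conv_bounded_linear[THEN iffD1] linearI)
         (auto simp: add_divide_distrib)
    have "dderiv (heis_X j f) h p = dderiv (\<lambda>x. Df x \<bullet> (axis j 1, 0) - ?l x * (Df x \<bullet> (0, 1))) h p" for h
      by (intro dderiv_cong eventually_mono[OF near]) (simp add: heis_X_def dderiv_eqI[OF Df])
    then have e: "dderiv (heis_X j f) h p =
        D2f p h \<bullet> (axis j 1, 0) - (?l p * (D2f p h \<bullet> (0, 1)) + ?l h * (Df p \<bullet> (0, 1)))" for h
      by (simp only: second[OF l])
    have Xj: "X j = (axis j 1, 0) - ?l p *\<^sub>R (0, 1)" by (simp add: X_def)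
    show ?thesis unfolding heis_X_def[of j "heis_X j f"] e Xj square by simp
  qed
  have Y: "heis_Y j (heis_Y j f) p = D2f p (Y j) \<bullet> Y j" for j
  proof -
    let ?l = "\<lambda>x :: 'n heis. - Re (fst x $ j) / 2"
    have l: "(?l has_derivative ?l) (at p)"
      by (intro bounded_linear_imp_has_derivative linear_conv_bounded_linear[THEN iffD1] linearI)
         (auto simp: diff_divide_distrib)
    have "dderiv (heis_Y j f) h p = dderiv (\<lambda>x. Df x \<bullet> (axis j \<i>, 0) - ?l x * (Df x \<bullet> (0, 1))) h p" for h
      by (intro dderiv_cong eventually_mono[OF near]) (simp add: heis_Y_def dderiv_eqI[OF Df])
    then have e: "dderiv (heis_Y j f) h p =
        D2f p h \<bullet> (axis j \<i>, 0) - (?l p * (D2f p h \<bullet> (0, 1)) + ?l h * (Df p \<bullet> (0, 1)))" for h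
      by (simp only: second[OF l])
    have Yj: "Y j = (axis j \<i>, 0) - ?l p *\<^sub>R (0, 1)" by (simp add: Y_def)
    show ?thesis unfolding heis_Y_def[of j "heis_Y j f"] e Yj square by (simp add: axis_def)
  qed
  show ?thesis by (simp add: heis_laplacian_def X Y)
qed

lemma herm_axis: "herm (axis j u) z = u * cnj (z $ j)"
proof -
  have "axis j u $ k * cnj (z $ k) = (if k = j then u * cnj (z $ j) else 0)" for k
    by (simp add: axis_def)
  then show ?thesis by (simp add: herm_def)
qed

text \<open>
  Consistency: on a second order Taylor polynomial at \<open>p\<close> the nonlocal operator equals the
  Heisenberg Laplacian up to a multiple of the second derivative in \<open>s\<close>. The identity has no
  remainder of its own.
\<close>

lemma rescaled_kernel_laplacian:
  fixes J :: "'n::finite heis \<Rightarrow> real" and f :: "'n heis \<Rightarrow> real"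
  assumes J: "admissible_kernel J C1" and \<epsilon>: "\<epsilon> > 0"
    and S: "open S" "p \<in> S"
    and Df: "\<And>x. x \<in> S \<Longrightarrow> (f has_derivative (\<lambda>h. Df x \<bullet> h)) (at x)"
    and D2f: "(Df has_derivative blinfun_apply (D2f p)) (at p)"
  shows "(\<integral>q. rescaled_kernel J C1 \<epsilon> (heis_diff p q) * (Df p \<bullet> (q - p) + D2f p (q - p) \<bullet> (q - p) / 2) \<partial>lborel)
    = \<epsilon>\<^sup>2 * heis_laplacian f p + \<epsilon> ^ 4 * (D2f p (0, 1) \<bullet> (0, 1))"
proof -
  have XY: "heis_shift \<epsilon> p (axis j 1, 0) = (- \<epsilon>) *\<^sub>R (axis j 1, - Im (fst p $ j) / 2)"
    "heis_shift \<epsilon> p (axis j \<i>, 0) = (- \<epsilon>) *\<^sub>R (axis j \<i>, Re (fst p $ j) / 2)" for j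
    by (simp_all add: heis_shift_def herm_axis)
  have S1: "heis_shift \<epsilon> p (0, 1) = (- \<epsilon>\<^sup>2) *\<^sub>R (0, 1)"
    by (simp add: heis_shift_def herm_def)
  have C1: "C1 \<noteq> 0" using admissible_kernel_second_moment_pos[OF J] by simp
  have L: "heis_laplacian f p = (\<Sum>j\<in>UNIV.
      D2f p (axis j 1, - Im (fst p $ j) / 2) \<bullet> (axis j 1, - Im (fst p $ j) / 2) +
      D2f p (axis j \<i>, Re (fst p $ j) / 2) \<bullet> (axis j \<i>, Re (fst p $ j) / 2))"
    by (rule heis_laplacian_eq[OF S]) (use Df D2f in auto)
  have sq: "D2f p (c *\<^sub>R a) \<bullet> (c *\<^sub>R a) = c\<^sup>2 * (D2f p a \<bullet> a)" for a c
    by (simp add: blinfun.scaleR_right power2_eq_square)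
  show ?thesis
    unfolding rescaled_kernel_quadratic[OF J C1 \<epsilon>] sum_Basis_heis XY S1 sq L
    by (simp add: sum_distrib_left distrib_left)
qed

section \<open>A comparison principle for nonlocal evolutions\<close>

lemma integral_tendsto_0_imp_continuous_pos_part:
  fixes z :: "'a \<Rightarrow> real \<Rightarrow> real"
  assumes int: "\<And>t. t \<in> S \<Longrightarrow> integrable M (\<lambda>p. z p t)"
    and L1: "\<And>t. t \<in> S \<Longrightarrow> ((\<lambda>\<tau>. \<integral>p. \<bar>z p \<tau> - z p t\<bar> \<partial>M) \<longlongrightarrow> 0) (at t within S)"
  shows "continuous_on S (\<lambda>t. \<integral>p. max 0 (z p t) \<partial>M)"
  unfolding continuous_on_def
proof
  fix t assume t: "t \<in> S"
  have "\<forall>\<^sub>F \<tau> in at t within S. norm ((\<integral>p. max 0 (z p \<tau>) \<partial>M) - (\<integral>p. max 0 (z p t) \<partial>M)) \<le> (\<integral>p. \<bar>z p \<tau> - z p t\<bar> \<partial>M)"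
    unfolding eventually_at_filter
  proof (intro always_eventually allI impI)
    fix \<tau> assume "\<tau> \<in> S"
    then have "norm ((\<integral>p. max 0 (z p \<tau>) \<partial>M) - (\<integral>p. max 0 (z p t) \<partial>M)) = norm (\<integral>p. max 0 (z p \<tau>) - max 0 (z p t) \<partial>M)"
      using t int by (subst Bochner_Integration.integral_diff) auto
    also have "\<dots> \<le> (\<integral>p. norm (max 0 (z p \<tau>) - max 0 (z p t)) \<partial>M)"
      by (rule integral_norm_bound)
    also have "\<dots> \<le> (\<integral>p. \<bar>z p \<tau> - z p t\<bar> \<partial>M)"
      using t \<open>\<tau> \<in> S\<close> int by (intro integral_mono) auto
    finally show "norm ((\<integral>p. max 0 (z p \<tau>) \<partial>M) - (\<integral>p. max 0 (z p t) \<partial>M)) \<le> (\<integral>p. \<bar>z p \<tau> - z p t\<bar> \<partial>M)" .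
  qed
  then have "((\<lambda>\<tau>. (\<integral>p. max 0 (z p \<tau>) \<partial>M) - (\<integral>p. max 0 (z p t) \<partial>M)) \<longlongrightarrow> 0) (at t within S)"
    by (rule Lim_null_comparison[OF _ L1[OF t]])
  then show "((\<lambda>\<tau>. \<integral>p. max 0 (z p \<tau>) \<partial>M) \<longlongrightarrow> (\<integral>p. max 0 (z p t) \<partial>M)) (at t within S)"
    by (rule LIM_zero_cancel)
qed

text \<open>
  A comparison principle for functions that are continuous in time and only integrable in
  space. With \<open>\<phi>\<close> the integral of the positive part of \<open>z\<close> and \<open>G\<close> the primitive of
  \<open>exp (m t) \<phi>\<close>, the differential inequality gives \<open>exp (m t) z p t \<le> \<kappa> G t\<close> for every \<open>p\<close>;
  integration over \<open>p\<close> yields \<open>G' \<le> \<kappa> \<mu> G\<close>, where \<open>\<mu>\<close> is the total mass, and \<open>G\<close> vanishes.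
\<close>

lemma nonlocal_comparison:
  fixes z :: "'a \<Rightarrow> real \<Rightarrow> real"
  assumes M: "finite_measure M" and \<kappa>: "0 \<le> \<kappa>"
    and int: "\<And>t. t \<in> {0..T} \<Longrightarrow> integrable M (\<lambda>p. z p t)"
    and L1: "\<And>t. t \<in> {0..T} \<Longrightarrow> ((\<lambda>\<tau>. \<integral>p. \<bar>z p \<tau> - z p t\<bar> \<partial>M) \<longlongrightarrow> 0) (at t within {0..T})"
    and cont: "\<And>p. p \<in> space M \<Longrightarrow> continuous_on {0..T} (z p)"
    and init: "\<And>p. p \<in> space M \<Longrightarrow> z p 0 \<le> 0"
    and der: "\<And>p t. p \<in> space M \<Longrightarrow> 0 < t \<Longrightarrow> t < T \<Longrightarrow>
       \<exists>z'. (z p has_real_derivative z') (at t) \<and> z' \<le> \<kappa> * (\<integral>q. max 0 (z q t) \<partial>M) - m * z p t"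
    and p: "p \<in> space M" and t: "t \<in> {0..T}"
  shows "z p t \<le> 0"
proof -
  interpret finite_measure M by fact
  define \<phi> where "\<phi> t = (\<integral>p. max 0 (z p t) \<partial>M)" for t
  define \<psi> where "\<psi> t = exp (m * t) * \<phi> t" for t
  define G where "G t = integral {0..t} \<psi>" for t
  define \<mu> where "\<mu> = measure M (space M)"
  have \<phi>0: "0 \<le> \<phi> t" for t unfolding \<phi>_def by (rule Bochner_Integration.integral_nonneg) simp
  have cont_\<phi>: "continuous_on {0..T} \<phi>"
    unfolding \<phi>_def by (rule integral_tendsto_0_imp_continuous_pos_part[OF int L1])
  have cont_\<psi>: "continuous_on {0..T} \<psi>" unfolding \<psi>_def by (intro continuous_intros cont_\<phi>)
  have G_der: "(G has_real_derivative \<psi> s) (at s within {0..T})" if "s \<in> {0..T}" for s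
    unfolding G_def using integral_has_real_derivative[OF cont_\<psi> that] .
  have cont_G: "continuous_on {0..T} G"
    using G_der by (meson DERIV_continuous continuous_on_eq_continuous_within)
  have G0: "0 \<le> G s" if "s \<in> {0..T}" for s
    unfolding G_def using that \<phi>0 cont_\<psi>
    by (intro integral_nonneg integrable_continuous_real) (auto simp: \<psi>_def intro: continuous_on_subset)
  \<comment> \<open>The function \<open>exp (m r) z p r - \<kappa> G r\<close> is nonincreasing.\<close>
  have pointwise: "exp (m * s) * z p s \<le> \<kappa> * G s" if p: "p \<in> space M" and s: "s \<in> {0..T}" for p s
  proof -
    let ?h = "\<lambda>r. exp (m * r) * z p r - \<kappa> * G r"
    have "?h s \<le> ?h 0"
    proof (rule DERIV_nonpos_imp_decreasing_open[where f = ?h])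
      show "0 \<le> s" using s by simp
      show "continuous_on {0..s} ?h"
        using s by (intro continuous_intros continuous_on_subset[OF cont[OF p]] continuous_on_subset[OF cont_G]) auto
      fix r assume r: "0 < r" "r < s"
      then have "r < T" using s by simp
      obtain z' where z': "(z p has_real_derivative z') (at r)" "z' \<le> \<kappa> * \<phi> r - m * z p r"
        using der[OF p r(1) \<open>r < T\<close>] unfolding \<phi>_def by blast
      have G: "(G has_real_derivative \<psi> r) (at r)"
        using G_der[of r] r \<open>r < T\<close> by (simp add: at_within_Icc_at)
      have "(?h has_real_derivative m * exp (m * r) * z p r + exp (m * r) * z' - \<kappa> * \<psi> r) (at r)"
        using z' G by (auto intro!: derivative_eq_intros)
      moreover have "m * exp (m * r) * z p r + exp (m * r) * z' - \<kappa> * \<psi> r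
          = exp (m * r) * (z' - (\<kappa> * \<phi> r - m * z p r))"
        by (simp add: \<psi>_def algebra_simps)
      then have "m * exp (m * r) * z p r + exp (m * r) * z' - \<kappa> * \<psi> r \<le> 0"
        using z'(2) by (simp add: mult_le_0_iff)
      ultimately show "\<exists>y. (?h has_real_derivative y) (at r) \<and> y \<le> 0" by blast
    qed
    moreover have "G 0 = 0" by (simp add: G_def)
    ultimately show ?thesis using init[OF p] by simp
  qed
  \<comment> \<open>As \<open>G\<close> is nonnegative, the pointwise bound passes to the positive part and can be integrated.\<close>
  have \<psi>_le: "\<psi> s \<le> \<kappa> * \<mu> * G s" if s: "s \<in> {0..T}" for s
  proof -
    have "\<psi> s = (\<integral>p. exp (m * s) * max 0 (z p s) \<partial>M)" by (simp add: \<psi>_def \<phi>_def)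
    also have "\<dots> \<le> (\<integral>p. \<kappa> * G s \<partial>M)"
    proof (rule integral_mono)
      show "integrable M (\<lambda>p. exp (m * s) * max 0 (z p s))" using int[OF s] by auto
      fix p assume "p \<in> space M"
      then show "exp (m * s) * max 0 (z p s) \<le> \<kappa> * G s"
        using pointwise[OF _ s] G0[OF s] \<kappa> by (auto simp: max_def)
    qed simp
    finally show ?thesis by (simp add: \<mu>_def mult.commute mult.left_commute)
  qed
  have G_le: "G s \<le> 0" if s: "s \<in> {0..T}" for s
  proof -
    let ?H = "\<lambda>r. exp (- (\<kappa> * \<mu> * r)) * G r"
    have "?H s \<le> ?H 0"
    proof (rule DERIV_nonpos_imp_decreasing_open[where f = ?H])
      show "0 \<le> s" using s by simp
      show "continuous_on {0..s} ?H"
        using s by (intro continuous_intros continuous_on_subset[OF cont_G]) auto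
      fix r assume r: "0 < r" "r < s"
      then have rT: "r < T" "r \<in> {0..T}" using s by auto
      have G: "(G has_real_derivative \<psi> r) (at r)"
        using G_der[of r] r rT by (simp add: at_within_Icc_at)
      have "(?H has_real_derivative exp (- (\<kappa> * \<mu> * r)) * (\<psi> r - \<kappa> * \<mu> * G r)) (at r)"
        using G by (auto intro!: derivative_eq_intros simp: algebra_simps)
      then show "\<exists>y. (?H has_real_derivative y) (at r) \<and> y \<le> 0"
        using \<psi>_le[OF rT(2)] by (intro exI conjI) (auto simp: mult_le_0_iff)
    qed
    then show ?thesis by (simp add: G_def mult_le_0_iff)
  qed
  have "exp (m * t) * z p t \<le> 0"
    using pointwise[OF p t] G_le[OF t] G0[OF t] by simp
  then show ?thesis by (simp add: mult_le_0_iff)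
qed

text \<open>
  The constant \<open>A\<close> is weighted by the full mass of the kernel, whereas \<open>\<zeta>\<close>, of which no more
  than integrability over \<open>\<Omega>\<close> is known, is weighted by the upper bound \<open>\<kappa>\<close> of the kernel.
\<close>

lemma kernel_integral_upper_bound:
  fixes K f \<zeta> :: "'a::euclidean_space \<Rightarrow> real"
  assumes \<Omega>: "\<Omega> \<in> sets lebesgue"
    and K: "\<And>q. 0 \<le> K q" "\<And>q. K q \<le> \<kappa>" "integrable lebesgue K"
    and f: "integrable lebesgue (\<lambda>q. K q * f q)"
    and \<zeta>: "integrable (lebesgue_on \<Omega>) \<zeta>" "\<And>q. 0 \<le> \<zeta> q"
    and inside: "\<And>q. K q \<noteq> 0 \<Longrightarrow> q \<in> \<Omega> \<Longrightarrow> f q \<le> \<zeta> q + A"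
    and outside: "\<And>q. K q \<noteq> 0 \<Longrightarrow> q \<notin> \<Omega> \<Longrightarrow> f q \<le> A"
  shows "(\<integral>q. K q * f q \<partial>lebesgue) \<le> \<kappa> * (\<integral>q. \<zeta> q \<partial>lebesgue_on \<Omega>) + A * (\<integral>q. K q \<partial>lebesgue)"
proof -
  have \<zeta>': "integrable lebesgue (\<lambda>q. indicator \<Omega> q *\<^sub>R \<zeta> q)"
    using \<zeta>(1) \<Omega> by (subst (asm) integrable_restrict_space) auto
  have "(\<integral>q. K q * f q \<partial>lebesgue) \<le> (\<integral>q. \<kappa> * (indicator \<Omega> q *\<^sub>R \<zeta> q) + A * K q \<partial>lebesgue)"
  proof (rule integral_mono)
    show "integrable lebesgue (\<lambda>q. \<kappa> * (indicator \<Omega> q *\<^sub>R \<zeta> q) + A * K q)"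
      by (intro Bochner_Integration.integrable_add integrable_mult_right \<zeta>' K)
    fix q
    have *: "K q * \<zeta> q \<le> \<kappa> * \<zeta> q" using K \<zeta> by (intro mult_right_mono)
    show "K q * f q \<le> \<kappa> * (indicator \<Omega> q *\<^sub>R \<zeta> q) + A * K q"
    proof (cases "K q = 0")
      case True
      then show ?thesis using K(2)[of q] \<zeta>(2)[of q] by (simp split: split_indicator)
    next
      case False
      show ?thesis
      proof (cases "q \<in> \<Omega>")
        case True
        then have "K q * f q \<le> K q * (\<zeta> q + A)" using inside False K by (intro mult_left_mono) auto
        then show ?thesis using * True by (simp add: algebra_simps)
      next
        case out: False
        then have "K q * f q \<le> K q * A" using outside False K by (intro mult_left_mono) auto
        then show ?thesis using out by (simp add: mult.commute)
      qed
    qed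
  qed (rule f)
  also have "\<dots> = \<kappa> * (\<integral>q. indicator \<Omega> q *\<^sub>R \<zeta> q \<partial>lebesgue) + A * (\<integral>q. K q \<partial>lebesgue)"
    by (subst Bochner_Integration.integral_add)
       (simp_all only: integrable_mult_right \<zeta>' K integral_mult_right_zero)
  also have "(\<integral>q. indicator \<Omega> q *\<^sub>R \<zeta> q \<partial>lebesgue) = (\<integral>q. \<zeta> q \<partial>lebesgue_on \<Omega>)"
    using \<Omega> by (subst integral_restrict_space) auto
  finally show ?thesis .
qed

section \<open>The error estimate\<close>

lemma parabolic_C2_holderE:
  fixes v :: "'a::euclidean_space \<Rightarrow> real \<Rightarrow> real"
  assumes v: "parabolic_C2_holder \<alpha> \<Omega> T v" and bd: "bounded \<Omega>"
  obtains Dv D2v M where "0 \<le> M"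
    and "\<And>x t. x \<in> \<Omega> \<Longrightarrow> t \<in> {0..T} \<Longrightarrow> ((\<lambda>y. v y t) has_derivative (\<lambda>h. Dv x t \<bullet> h)) (at x)"
    and "\<And>x t. x \<in> \<Omega> \<Longrightarrow> t \<in> {0..T} \<Longrightarrow> ((\<lambda>y. Dv y t) has_derivative blinfun_apply (D2v x t)) (at x)"
    and "\<And>t. t \<in> {0..T} \<Longrightarrow> continuous_on \<Omega> (\<lambda>x. D2v x t)"
    and "\<And>x t. x \<in> \<Omega> \<Longrightarrow> t \<in> {0..T} \<Longrightarrow> norm (Dv x t) \<le> M"
    and "\<And>x t. x \<in> \<Omega> \<Longrightarrow> t \<in> {0..T} \<Longrightarrow> norm (D2v x t) \<le> M"
    and "\<And>x y t. x \<in> \<Omega> \<Longrightarrow> y \<in> \<Omega> \<Longrightarrow> t \<in> {0..T} \<Longrightarrow> norm (D2v x t - D2v y t) \<le> M * dist x y powr \<alpha>"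
proof -
  obtain Dv D2v vt where
    Dv: "\<And>x t. x \<in> \<Omega> \<Longrightarrow> t \<in> {0..T} \<Longrightarrow> ((\<lambda>y. v y t) has_derivative (\<lambda>h. Dv x t \<bullet> h)) (at x)"
    and D2v: "\<And>x t. x \<in> \<Omega> \<Longrightarrow> t \<in> {0..T} \<Longrightarrow> ((\<lambda>y. Dv y t) has_derivative blinfun_apply (D2v x t)) (at x)"
    and c1: "continuous_on (closure \<Omega> \<times> {0..T}) (\<lambda>(x, t). Dv x t)"
    and c2: "continuous_on (closure \<Omega> \<times> {0..T}) (\<lambda>(x, t). D2v x t)"
    and h: "holder_unif \<alpha> (closure \<Omega>) {0..T} (\<lambda>t x. D2v x t)"
    using v unfolding parabolic_C2_holder_def by (elim exE conjE) (rule that, auto)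
  have sub: "\<Omega> \<subseteq> closure \<Omega>" by (rule closure_subset)
  have cpt: "compact (closure \<Omega> \<times> {0..T})" using bd by (intro compact_Times) auto
  have bound: "\<exists>B. \<forall>x\<in>closure \<Omega>. \<forall>t\<in>{0..T}. norm (f x t) \<le> B"
    if "continuous_on (closure \<Omega> \<times> {0..T}) (\<lambda>(x, t). f x t)" for f :: "'a \<Rightarrow> real \<Rightarrow> 'c::real_normed_vector"
    using compact_imp_bounded[OF compact_continuous_image[OF that cpt]]
    unfolding bounded_iff by fastforce
  obtain B1 where B1: "\<And>x t. x \<in> closure \<Omega> \<Longrightarrow> t \<in> {0..T} \<Longrightarrow> norm (Dv x t) \<le> B1"
    using bound[OF c1] by blast
  obtain B2 where B2: "\<And>x t. x \<in> closure \<Omega> \<Longrightarrow> t \<in> {0..T} \<Longrightarrow> norm (D2v x t) \<le> B2"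
    using bound[OF c2] by blast
  obtain K where K: "\<And>x y t. x \<in> closure \<Omega> \<Longrightarrow> y \<in> closure \<Omega> \<Longrightarrow> t \<in> {0..T} \<Longrightarrow>
      dist (D2v x t) (D2v y t) \<le> K * dist x y powr \<alpha>"
    using h unfolding holder_unif_def by blast
  define M where "M = \<bar>B1\<bar> + \<bar>B2\<bar> + \<bar>K\<bar>"
  have M: "0 \<le> M" "B1 \<le> M" "B2 \<le> M" "K \<le> M" by (simp_all add: M_def)
  show thesis
  proof (rule that[OF M(1) Dv D2v])
    fix x y t assume x: "x \<in> \<Omega>" and t: "t \<in> {0..T}"
    show "norm (Dv x t) \<le> M" using B1[of x t] x t sub M by force
    show "norm (D2v x t) \<le> M" using B2[of x t] x t sub M by force
    assume y: "y \<in> \<Omega>"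
    have "norm (D2v x t - D2v y t) \<le> K * dist x y powr \<alpha>"
      using K[of x y t] x y t sub by (auto simp: dist_norm)
    also have "\<dots> \<le> M * dist x y powr \<alpha>" using M by (intro mult_right_mono) auto
    finally show "norm (D2v x t - D2v y t) \<le> M * dist x y powr \<alpha>" .
  next
    fix t assume t: "t \<in> {0..T}"
    show "continuous_on \<Omega> (\<lambda>x. D2v x t)"
      using continuous_on_compose2[OF c2, of \<Omega> "\<lambda>x. (x, t)"] t sub
      by (force intro!: continuous_intros)
  qed
qed

lemma continuous_on_compact_times_L1:
  fixes v :: "'a::euclidean_space \<Rightarrow> real \<Rightarrow> real"
  assumes \<Omega>: "open \<Omega>" "bounded \<Omega>"
    and cont: "continuous_on (closure \<Omega> \<times> {0..T}) (\<lambda>(x, t). v x t)"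
    and t: "t \<in> {0..T}"
  shows "integrable (lebesgue_on \<Omega>) (\<lambda>x. v x t)"
    and "((\<lambda>\<tau>. \<integral>x. \<bar>v x \<tau> - v x t\<bar> \<partial>lebesgue_on \<Omega>) \<longlongrightarrow> 0) (at t within {0..T})"
proof -
  have cpt: "compact (closure \<Omega> \<times> {0..T})" using \<Omega> by (intro compact_Times) auto
  have \<Omega>_leb: "\<Omega> \<in> sets lebesgue" using \<Omega>(1) by (simp add: borel_open)
  interpret finite_measure "lebesgue_on \<Omega>"
    using \<Omega> by (intro finite_measure_lebesgue_on lmeasurable_open)
  obtain B where B: "\<And>x t. x \<in> closure \<Omega> \<Longrightarrow> t \<in> {0..T} \<Longrightarrow> norm (v x t) \<le> B"
    using compact_imp_bounded[OF compact_continuous_image[OF cont cpt]] unfolding bounded_iff by fastforce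
  have int: "integrable (lebesgue_on \<Omega>) (\<lambda>x. v x t)" if t: "t \<in> {0..T}" for t
  proof (rule integrable_const_bound[where B = B])
    show "AE x in lebesgue_on \<Omega>. norm (v x t) \<le> B"
      using B[OF _ t] closure_subset by (intro AE_I2) force
    have "continuous_on \<Omega> (\<lambda>x. v x t)"
      using continuous_on_compose2[OF cont, of \<Omega> "\<lambda>x. (x, t)"] t closure_subset
      by (force intro!: continuous_intros)
    then show "(\<lambda>x. v x t) \<in> borel_measurable (lebesgue_on \<Omega>)"
      using \<Omega>_leb by (rule continuous_imp_measurable_on_sets_lebesgue)
  qed
  show "integrable (lebesgue_on \<Omega>) (\<lambda>x. v x t)" by (rule int[OF t])
  show "((\<lambda>\<tau>. \<integral>x. \<bar>v x \<tau> - v x t\<bar> \<partial>lebesgue_on \<Omega>) \<longlongrightarrow> 0) (at t within {0..T})"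
  proof (rule tendstoI)
    fix e :: real assume "e > 0"
    define \<mu> where "\<mu> = measure (lebesgue_on \<Omega>) \<Omega>"
    define e' where "e' = e / (\<mu> + 1)"
    have \<mu>: "0 \<le> \<mu>" by (simp add: \<mu>_def)
    have e': "0 < e'" "\<mu> * e' < e" using \<open>e > 0\<close> \<mu> by (simp_all add: e'_def field_simps)
    obtain d where d: "d > 0" "\<And>a b. a \<in> closure \<Omega> \<times> {0..T} \<Longrightarrow> b \<in> closure \<Omega> \<times> {0..T} \<Longrightarrow> dist b a < d \<Longrightarrow>
        dist (case b of (x, t) \<Rightarrow> v x t) (case a of (x, t) \<Rightarrow> v x t) < e'"
      using compact_uniformly_continuous[OF cont cpt] e'(1) unfolding uniformly_continuous_on_def by metis
    have "dist (\<integral>x. \<bar>v x \<tau> - v x t\<bar> \<partial>lebesgue_on \<Omega>) 0 < e" if \<tau>: "\<tau> \<in> {0..T}" "dist \<tau> t < d" for \<tau>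
    proof -
      have "(\<integral>x. \<bar>v x \<tau> - v x t\<bar> \<partial>lebesgue_on \<Omega>) \<le> (\<integral>x. e' \<partial>lebesgue_on \<Omega>)"
      proof (rule integral_mono)
        show "integrable (lebesgue_on \<Omega>) (\<lambda>x. \<bar>v x \<tau> - v x t\<bar>)" using int[OF t] int[OF \<tau>(1)] by simp
        fix x assume "x \<in> space (lebesgue_on \<Omega>)"
        then have "x \<in> closure \<Omega>" using closure_subset by auto
        then show "\<bar>v x \<tau> - v x t\<bar> \<le> e'"
          using d(2)[of "(x, t)" "(x, \<tau>)"] \<tau> t by (simp add: dist_Pair_Pair dist_real_def)
      qed simp
      then have "(\<integral>x. \<bar>v x \<tau> - v x t\<bar> \<partial>lebesgue_on \<Omega>) < e" using e' by (simp add: \<mu>_def)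
      moreover have "0 \<le> (\<integral>x. \<bar>v x \<tau> - v x t\<bar> \<partial>lebesgue_on \<Omega>)"
        by (intro Bochner_Integration.integral_nonneg) simp
      ultimately show ?thesis by simp
    qed
    then show "\<forall>\<^sub>F \<tau> in at t within {0..T}. dist (\<integral>x. \<bar>v x \<tau> - v x t\<bar> \<partial>lebesgue_on \<Omega>) 0 < e"
      using d(1) unfolding eventually_at by blast
  qed
qed

text \<open>
  The interior Taylor error \<open>E\<close> is divided by \<open>\<epsilon>\<^sup>2\<close> and accumulates in time, whereas the exterior
  error \<open>B\<close> enters as it stands, being absorbed into the barrier \<open>B + c t\<close>.
\<close>

lemma nonlocal_error_bound:
  fixes J :: "'n::finite heis \<Rightarrow> real" and u v g :: "'n heis \<Rightarrow> real \<Rightarrow> real"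
    and Dv :: "'n heis \<Rightarrow> real \<Rightarrow> 'n heis" and D2v :: "'n heis \<Rightarrow> real \<Rightarrow> 'n heis \<Rightarrow>\<^sub>L 'n heis"
  defines "Q p t q \<equiv> Dv p t \<bullet> (q - p) + D2v p t (q - p) \<bullet> (q - p) / 2"
  assumes J: "admissible_kernel J C1" and \<epsilon>: "\<epsilon> > 0" and \<Omega>: "open \<Omega>" "bounded \<Omega>"
    and u: "nonlocal_solution J C1 \<epsilon> \<Omega> T g u0 u"
    and v_int: "\<And>t. t \<in> {0..T} \<Longrightarrow> integrable (lebesgue_on \<Omega>) (\<lambda>p. v p t)"
    and v_L1: "\<And>t. t \<in> {0..T} \<Longrightarrow>
       ((\<lambda>\<tau>. \<integral>p. \<bar>v p \<tau> - v p t\<bar> \<partial>lebesgue_on \<Omega>) \<longlongrightarrow> 0) (at t within {0..T})"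
    and v_cont: "\<And>p. p \<in> \<Omega> \<Longrightarrow> continuous_on {0..T} (v p)"
    and v_0: "\<And>p. p \<in> \<Omega> \<Longrightarrow> v p 0 = u0 p"
    and v_t: "\<And>p t. p \<in> \<Omega> \<Longrightarrow> t \<in> {0<..T} \<Longrightarrow>
       (v p has_real_derivative heis_laplacian (\<lambda>q. v q t) p) (at t within {0..T})"
    and Dv: "\<And>x t. x \<in> \<Omega> \<Longrightarrow> t \<in> {0..T} \<Longrightarrow> ((\<lambda>y. v y t) has_derivative (\<lambda>h. Dv x t \<bullet> h)) (at x)"
    and D2v: "\<And>x t. x \<in> \<Omega> \<Longrightarrow> t \<in> {0..T} \<Longrightarrow> ((\<lambda>y. Dv y t) has_derivative blinfun_apply (D2v x t)) (at x)"
    and M: "\<And>x t. x \<in> \<Omega> \<Longrightarrow> t \<in> {0..T} \<Longrightarrow> norm (D2v x t) \<le> M"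
    and inside: "\<And>p q t. p \<in> \<Omega> \<Longrightarrow> q \<in> \<Omega> \<Longrightarrow> t \<in> {0<..T} \<Longrightarrow>
       rescaled_kernel J C1 \<epsilon> (heis_diff p q) \<noteq> 0 \<Longrightarrow> \<bar>v q t - (v p t + Q p t q)\<bar> \<le> E"
    and outside: "\<And>p q t. p \<in> \<Omega> \<Longrightarrow> q \<notin> \<Omega> \<Longrightarrow> t \<in> {0<..T} \<Longrightarrow>
       rescaled_kernel J C1 \<epsilon> (heis_diff p q) \<noteq> 0 \<Longrightarrow> \<bar>g q t - (v p t + Q p t q)\<bar> \<le> B"
    and nonneg: "0 \<le> E" "0 \<le> B" "0 \<le> M"
    and p: "p \<in> \<Omega>" and t: "t \<in> {0..T}"
  shows "\<bar>u p t - v p t\<bar> \<le> B + (2 / C1 * E / \<epsilon>\<^sup>2 + \<epsilon>\<^sup>2 * M) * t"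
proof -
  define c where "c = 2 / C1 * E / \<epsilon>\<^sup>2 + \<epsilon>\<^sup>2 * M"
  have C1: "0 < C1" by (rule admissible_kernel_second_moment_pos[OF J])
  have c0: "0 \<le> c" using C1 nonneg by (simp add: c_def)
  have u_int: "integrable (lebesgue_on \<Omega>) (\<lambda>p. u p t)" if "t \<in> {0..T}" for t
    using u that by (simp add: nonlocal_solution_def)
  have u_L1: "((\<lambda>\<tau>. \<integral>p. \<bar>u p \<tau> - u p t\<bar> \<partial>lebesgue_on \<Omega>) \<longlongrightarrow> 0) (at t within {0..T})" if "t \<in> {0..T}" for t
    using u that by (simp add: nonlocal_solution_def)
  have u_cont: "continuous_on {0..T} (u p)" if "p \<in> \<Omega>" for p
    using u that by (simp add: nonlocal_solution_def)
  have \<Omega>_leb: "\<Omega> \<in> sets lebesgue" using \<Omega>(1) by (simp add: borel_open)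
  have fin: "finite_measure (lebesgue_on \<Omega>)"
    using \<Omega> by (intro finite_measure_lebesgue_on lmeasurable_open)
  interpret finite_measure "lebesgue_on \<Omega>" by (rule fin)
  obtain \<kappa> where \<kappa>: "0 \<le> \<kappa>" "\<And>w. 0 \<le> rescaled_kernel J C1 \<epsilon> w" "\<And>w. rescaled_kernel J C1 \<epsilon> w \<le> \<kappa>"
    by (rule rescaled_kernel_bounded[OF J \<epsilon>]) blast
  have one_sided: "\<sigma> * (u p t - v p t) - (B + c * t) \<le> 0" if \<sigma>: "\<sigma> = 1 \<or> \<sigma> = - 1" for \<sigma> :: real
  proof -
    define z where "z p t = \<sigma> * (u p t - v p t) - (B + c * t)" for p t
    have z_int: "integrable (lebesgue_on \<Omega>) (\<lambda>p. z p t)" if "t \<in> {0..T}" for t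
      unfolding z_def using u_int[OF that] v_int[OF that] by auto
    have "z p t \<le> 0"
    proof (rule nonlocal_comparison[where z = z and M = "lebesgue_on \<Omega>" and \<kappa> = "\<kappa> / \<epsilon>\<^sup>2" and m = "2 / C1 / \<epsilon>\<^sup>2" and T = T])
      show "finite_measure (lebesgue_on \<Omega>)" by (rule fin)
      show "0 \<le> \<kappa> / \<epsilon>\<^sup>2" using \<kappa> by simp
      show "integrable (lebesgue_on \<Omega>) (\<lambda>p. z p t)" if "t \<in> {0..T}" for t by (rule z_int[OF that])
      show "((\<lambda>\<tau>. \<integral>p. \<bar>z p \<tau> - z p t\<bar> \<partial>lebesgue_on \<Omega>) \<longlongrightarrow> 0) (at t within {0..T})" if t: "t \<in> {0..T}" for t
      proof (rule Lim_null_comparison)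
        let ?b = "\<lambda>\<tau>. (\<integral>p. \<bar>u p \<tau> - u p t\<bar> \<partial>lebesgue_on \<Omega>) + (\<integral>p. \<bar>v p \<tau> - v p t\<bar> \<partial>lebesgue_on \<Omega>)
            + measure (lebesgue_on \<Omega>) \<Omega> * \<bar>c * \<tau> - c * t\<bar>"
        have "((\<lambda>\<tau>. \<bar>c * \<tau> - c * t\<bar>) \<longlongrightarrow> \<bar>c * t - c * t\<bar>) (at t within {0..T})"
          by (intro tendsto_intros)
        then have "(?b \<longlongrightarrow> 0 + 0 + measure (lebesgue_on \<Omega>) \<Omega> * \<bar>c * t - c * t\<bar>) (at t within {0..T})"
          by (intro tendsto_intros u_L1[OF t] v_L1[OF t])
        then show "(?b \<longlongrightarrow> 0) (at t within {0..T})" by simp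
        show "\<forall>\<^sub>F \<tau> in at t within {0..T}. norm (\<integral>p. \<bar>z p \<tau> - z p t\<bar> \<partial>lebesgue_on \<Omega>) \<le> ?b \<tau>"
          unfolding eventually_at_filter
        proof (intro always_eventually allI impI)
          fix \<tau> assume \<tau>: "\<tau> \<in> {0..T}"
          have iu: "integrable (lebesgue_on \<Omega>) (\<lambda>p. \<bar>u p \<tau> - u p t\<bar>)"
            and iv: "integrable (lebesgue_on \<Omega>) (\<lambda>p. \<bar>v p \<tau> - v p t\<bar>)"
            using u_int t \<tau> v_int by auto
          have "norm (\<integral>p. \<bar>z p \<tau> - z p t\<bar> \<partial>lebesgue_on \<Omega>) = (\<integral>p. \<bar>z p \<tau> - z p t\<bar> \<partial>lebesgue_on \<Omega>)"
            by (simp add: integral_nonneg_AE)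
          also have "\<dots> \<le> (\<integral>p. \<bar>u p \<tau> - u p t\<bar> + \<bar>v p \<tau> - v p t\<bar> + \<bar>c * \<tau> - c * t\<bar> \<partial>lebesgue_on \<Omega>)"
          proof (rule integral_mono)
            show "integrable (lebesgue_on \<Omega>) (\<lambda>p. \<bar>z p \<tau> - z p t\<bar>)"
              using z_int[OF t] z_int[OF \<tau>] by simp
            show "integrable (lebesgue_on \<Omega>) (\<lambda>p. \<bar>u p \<tau> - u p t\<bar> + \<bar>v p \<tau> - v p t\<bar> + \<bar>c * \<tau> - c * t\<bar>)"
              using iu iv by simp
            show "\<bar>z p \<tau> - z p t\<bar> \<le> \<bar>u p \<tau> - u p t\<bar> + \<bar>v p \<tau> - v p t\<bar> + \<bar>c * \<tau> - c * t\<bar>" for p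
            proof -
              have "z p \<tau> - z p t = \<sigma> * (u p \<tau> - u p t) - \<sigma> * (v p \<tau> - v p t) - (c * \<tau> - c * t)"
                by (simp add: z_def algebra_simps)
              moreover have "\<bar>\<sigma> * x\<bar> = \<bar>x\<bar>" for x using \<sigma> by auto
              ultimately show ?thesis
                using abs_triangle_ineq4[of "\<sigma> * (u p \<tau> - u p t) - \<sigma> * (v p \<tau> - v p t)" "c * \<tau> - c * t"]
                  abs_triangle_ineq4[of "\<sigma> * (u p \<tau> - u p t)" "\<sigma> * (v p \<tau> - v p t)"]
                by simp
            qed
          qed
          also have "\<dots> = ?b \<tau>"
            using iu iv by simp
          finally show "norm (\<integral>p. \<bar>z p \<tau> - z p t\<bar> \<partial>lebesgue_on \<Omega>) \<le> ?b \<tau>" .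
        qed
      qed
      show "continuous_on {0..T} (z p)" if "p \<in> space (lebesgue_on \<Omega>)" for p
        unfolding z_def using that by (intro continuous_intros u_cont v_cont) auto
      show "z p 0 \<le> 0" if "p \<in> space (lebesgue_on \<Omega>)" for p
        using that u v_0 nonneg by (simp add: z_def nonlocal_solution_def)
      show "p \<in> space (lebesgue_on \<Omega>)" "t \<in> {0..T}" using p t by auto
      fix p t assume "p \<in> space (lebesgue_on \<Omega>)" and t: "0 < t" "t < T"
      then have p: "p \<in> \<Omega>" and t': "t \<in> {0<..T}" "t \<in> {0..T}" by auto
      let ?K = "\<lambda>q. rescaled_kernel J C1 \<epsilon> (heis_diff p q)"
      let ?L = "heis_laplacian (\<lambda>q. v q t) p"
      let ?s = "D2v p t (0, 1) \<bullet> (0, 1)"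
      define I where "I = (\<integral>q. ?K q * (u q t - u p t) \<partial>lebesgue)"
      have I_int: "integrable lebesgue (\<lambda>q. ?K q * (u q t - u p t))"
        and u_der: "(u p has_real_derivative 1 / \<epsilon>\<^sup>2 * I) (at t within {0..T})"
        using u p t' unfolding nonlocal_solution_def I_def by blast+
      have contQ: "continuous_on UNIV (Q p t)" unfolding Q_def by (intro continuous_intros) auto
      have Q_int': "integrable lborel (\<lambda>q. ?K q * Q p t q)" by (rule rescaled_kernel_integral(1)[OF J \<epsilon> contQ])
      then have Q_int: "integrable lebesgue (\<lambda>q. ?K q * Q p t q)" by (simp add: integrable_completion)
      have "(\<integral>q. ?K q * Q p t q \<partial>lborel) = \<epsilon>\<^sup>2 * ?L + \<epsilon> ^ 4 * ?s"
        unfolding Q_def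
        by (rule rescaled_kernel_laplacian[OF J \<epsilon> \<Omega>(1) p]) (use Dv D2v p t' in auto)
      then have Q_val: "(\<integral>q. ?K q * Q p t q \<partial>lebesgue) = \<epsilon>\<^sup>2 * ?L + \<epsilon> ^ 4 * ?s"
        using Q_int' by (simp add: integral_completion)
      have K_int': "integrable lborel ?K"
        using rescaled_kernel_integral(1)[OF J \<epsilon>, of "\<lambda>_. 1" p] by simp
      then have K_int: "integrable lebesgue ?K" by (simp add: integrable_completion)
      have K_val: "(\<integral>q. ?K q \<partial>lebesgue) = 2 / C1"
        using K_int' rescaled_kernel_mass[OF J \<epsilon>, of p] by (simp add: integral_completion)
      let ?w = "\<sigma> * (u p t - v p t)"
      let ?A = "B + c * t + E - ?w"
      let ?f = "\<lambda>q. \<sigma> * ((u q t - u p t) - Q p t q)"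
      have split: "?K q * ?f q = \<sigma> * (?K q * (u q t - u p t)) - \<sigma> * (?K q * Q p t q)" for q
        by (simp add: algebra_simps)
      \<comment> \<open>Compare \<open>u\<close> with the Taylor polynomial of \<open>v\<close>, both taken relative to their values at \<open>p\<close>.\<close>
      have ct: "0 \<le> c * t" using c0 t by simp
      have abs\<sigma>: "\<sigma> * x \<le> \<bar>x\<bar>" for x using \<sigma> by auto
      have "(\<integral>q. ?K q * ?f q \<partial>lebesgue) \<le>
         \<kappa> * (\<integral>q. max 0 (z q t) \<partial>lebesgue_on \<Omega>) + ?A * (\<integral>q. ?K q \<partial>lebesgue)"
      proof (rule kernel_integral_upper_bound[OF \<Omega>_leb \<kappa>(2) \<kappa>(3) K_int])
        show "integrable lebesgue (\<lambda>q. ?K q * ?f q)"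
          unfolding split by (intro Bochner_Integration.integrable_diff integrable_mult_right I_int Q_int)
        show "integrable (lebesgue_on \<Omega>) (\<lambda>q. max 0 (z q t))" using z_int[OF t'(2)] by auto
        show "0 \<le> max 0 (z q t)" for q by simp
        fix q assume K: "?K q \<noteq> 0"
        show "?f q \<le> max 0 (z q t) + ?A" if q: "q \<in> \<Omega>"
        proof -
          have "?f q = \<sigma> * (u q t - v q t) - ?w + \<sigma> * (v q t - (v p t + Q p t q))"
            by (simp add: algebra_simps)
          also have "\<dots> \<le> \<sigma> * (u q t - v q t) - ?w + E"
            using abs\<sigma>[of "v q t - (v p t + Q p t q)"] inside[OF p q t'(1) K] by linarith
          also have "\<dots> \<le> max 0 (z q t) + ?A" by (simp add: z_def)
          finally show ?thesis .
        qed
        show "?f q \<le> ?A" if q: "q \<notin> \<Omega>"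
        proof -
          have "u q t = g q t" using u q t' unfolding nonlocal_solution_def by blast
          then have "?f q = \<sigma> * (g q t - (v p t + Q p t q)) - ?w"
            by (simp add: algebra_simps)
          also have "\<dots> \<le> ?A"
            using abs\<sigma>[of "g q t - (v p t + Q p t q)"] outside[OF p q t'(1) K] ct nonneg by linarith
          finally show ?thesis .
        qed
      qed
      moreover have "(\<integral>q. ?K q * ?f q \<partial>lebesgue) = \<sigma> * (I - \<epsilon>\<^sup>2 * ?L - \<epsilon> ^ 4 * ?s)"
      proof -
        have "(\<integral>q. ?K q * ?f q \<partial>lebesgue) =
            (\<integral>q. \<sigma> * (?K q * (u q t - u p t)) \<partial>lebesgue) - (\<integral>q. \<sigma> * (?K q * Q p t q) \<partial>lebesgue)"
          unfolding split by (intro Bochner_Integration.integral_diff integrable_mult_right I_int Q_int)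
        then show ?thesis
          by (simp only: integral_mult_right_zero Q_val I_def[symmetric]) (simp add: algebra_simps)
      qed
      ultimately have bound: "\<sigma> * (I - \<epsilon>\<^sup>2 * ?L - \<epsilon> ^ 4 * ?s) \<le>
          \<kappa> * (\<integral>q. max 0 (z q t) \<partial>lebesgue_on \<Omega>) + ?A * (2 / C1)"
        by (simp only: K_val)
      have "norm ((0, 1) :: 'n heis) = 1" by (simp add: norm_Pair)
      then have "\<bar>?s\<bar> \<le> M"
        using Cauchy_Schwarz_ineq2[of "D2v p t (0, 1)" "(0, 1)"] norm_blinfun[of "D2v p t" "(0, 1)"] M[OF p t'(2)]
        by simp
      then have s: "\<sigma> * ?s \<le> M" using abs\<sigma>[of ?s] by linarith
      have at: "at t within {0..T} = at t" using t by (simp add: at_within_Icc_at)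
      have der: "(z p has_real_derivative \<sigma> * (1 / \<epsilon>\<^sup>2 * I - ?L) - c) (at t)"
        unfolding z_def using u_der v_t[OF p t'(1)] unfolding at by (auto intro!: derivative_eq_intros)
      have "\<sigma> * (1 / \<epsilon>\<^sup>2 * I - ?L) - c = \<sigma> * (I - \<epsilon>\<^sup>2 * ?L - \<epsilon> ^ 4 * ?s) / \<epsilon>\<^sup>2 + \<epsilon>\<^sup>2 * (\<sigma> * ?s) - c"
      proof -
        have "\<sigma> * (1 / e * I - l) = \<sigma> * (I - e * l - e\<^sup>2 * s) / e + e * (\<sigma> * s)" if "e \<noteq> 0" for e l s :: real
          using that by (simp add: field_simps power2_eq_square)
        from this[of "\<epsilon>\<^sup>2" ?L ?s] \<epsilon> show ?thesis by (simp only: power_even_abs power_mult[symmetric]) simp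
      qed
      also have "\<dots> \<le> (\<kappa> * (\<integral>q. max 0 (z q t) \<partial>lebesgue_on \<Omega>) + ?A * (2 / C1)) / \<epsilon>\<^sup>2 + \<epsilon>\<^sup>2 * M - c"
        using bound s by (intro diff_right_mono add_mono divide_right_mono mult_left_mono) auto
      also have "\<dots> = \<kappa> / \<epsilon>\<^sup>2 * (\<integral>q. max 0 (z q t) \<partial>lebesgue_on \<Omega>) - 2 / C1 / \<epsilon>\<^sup>2 * z p t"
      proof -
        have "(X + (b + E - w) * m) / e + e * M - (m * E / e + e * M) = X / e - m / e * (w - b)" for X b w m e :: real
          by (simp add: add_divide_distrib diff_divide_distrib algebra_simps)
        from this[of "\<kappa> * (\<integral>q. max 0 (z q t) \<partial>lebesgue_on \<Omega>)" "B + c * t" ?w "2 / C1" "\<epsilon>\<^sup>2"]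
        show ?thesis unfolding z_def[of p t] c_def[symmetric] by simp
      qed
      finally show "\<exists>z'. (z p has_real_derivative z') (at t) \<and>
          z' \<le> \<kappa> / \<epsilon>\<^sup>2 * (\<integral>q. max 0 (z q t) \<partial>lebesgue_on \<Omega>) - 2 / C1 / \<epsilon>\<^sup>2 * z p t"
        using der by blast
    qed
    then show ?thesis by (simp add: z_def)
  qed
  show ?thesis using one_sided[of 1] one_sided[of "- 1"] by (simp add: c_def abs_le_iff)
qed

theorem theorem1p5:
  fixes \<Omega> :: "'n::finite heis set"
    and J :: "'n heis \<Rightarrow> real"
    and g v :: "'n heis \<Rightarrow> real \<Rightarrow> real"
    and u0 :: "'n heis \<Rightarrow> real"
    and u :: "real \<Rightarrow> 'n heis \<Rightarrow> real \<Rightarrow> real"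
    and \<alpha> T C1 :: real
  assumes "0 < \<alpha>" and "\<alpha> < 1" and "0 < T"
    and "bounded_C2_holder_domain \<alpha> \<Omega>"
    and "admissible_kernel J C1"
    and "holder_at_boundary \<alpha> \<Omega> T g"
    and "local_solution \<alpha> \<Omega> T g u0 v"
    and "\<And>\<epsilon>. \<epsilon> > 0 \<Longrightarrow> nonlocal_solution J C1 \<epsilon> \<Omega> T g u0 (u \<epsilon>)"
  shows "\<exists>C::real. \<forall>\<^sub>F \<epsilon> in at_right 0.
           (SUP t\<in>{0..T}. esssup (lebesgue_on \<Omega>) (\<lambda>p. ereal \<bar>u \<epsilon> p t - v p t\<bar>))
             \<le> ereal (C * \<epsilon> powr \<alpha>)"
proof -
  note \<alpha> = assms(1,2) and J = assms(5)
  have \<Omega>: "open \<Omega>" "bounded \<Omega>" using assms(4) by (auto simp: bounded_C2_holder_domain_def)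
  have \<Omega>_leb: "\<Omega> \<in> sets lebesgue" using \<Omega>(1) by (simp add: borel_open)
  have par: "parabolic_C2_holder \<alpha> \<Omega> T v"
    and v_t: "\<And>p t. p \<in> \<Omega> \<Longrightarrow> t \<in> {0<..T} \<Longrightarrow>
       (v p has_real_derivative heis_laplacian (\<lambda>q. v q t) p) (at t within {0..T})"
    and v_bd: "\<And>p t. p \<in> frontier \<Omega> \<Longrightarrow> t \<in> {0<..T} \<Longrightarrow> v p t = g p t"
    and v_0: "\<And>p. p \<in> \<Omega> \<Longrightarrow> v p 0 = u0 p"
    using assms(7) unfolding local_solution_def by blast+
  have v_cont: "continuous_on (closure \<Omega> \<times> {0..T}) (\<lambda>(x, t). v x t)"
    using par unfolding parabolic_C2_holder_def by blast
  have C1: "0 < C1" by (rule admissible_kernel_second_moment_pos[OF J])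
  obtain Dv D2v M where M0: "0 \<le> M"
    and Dv: "\<And>x t. x \<in> \<Omega> \<Longrightarrow> t \<in> {0..T} \<Longrightarrow> ((\<lambda>y. v y t) has_derivative (\<lambda>h. Dv x t \<bullet> h)) (at x)"
    and D2v: "\<And>x t. x \<in> \<Omega> \<Longrightarrow> t \<in> {0..T} \<Longrightarrow> ((\<lambda>y. Dv y t) has_derivative blinfun_apply (D2v x t)) (at x)"
    and D2v_cont: "\<And>t. t \<in> {0..T} \<Longrightarrow> continuous_on \<Omega> (\<lambda>x. D2v x t)"
    and Dv_le: "\<And>x t. x \<in> \<Omega> \<Longrightarrow> t \<in> {0..T} \<Longrightarrow> norm (Dv x t) \<le> M"
    and D2v_le: "\<And>x t. x \<in> \<Omega> \<Longrightarrow> t \<in> {0..T} \<Longrightarrow> norm (D2v x t) \<le> M"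
    and D2v_holder: "\<And>x y t. x \<in> \<Omega> \<Longrightarrow> y \<in> \<Omega> \<Longrightarrow> t \<in> {0..T} \<Longrightarrow>
        norm (D2v x t - D2v y t) \<le> M * dist x y powr \<alpha>"
    by (rule parabolic_C2_holderE[OF par \<Omega>(2)]) blast
  obtain L \<delta>1 where \<delta>1: "0 < \<delta>1" and L0: "0 \<le> L"
    and L: "\<And>p q. p \<in> \<Omega> \<Longrightarrow> q \<in> \<Omega> \<Longrightarrow> dist p q < \<delta>1 \<Longrightarrow> linked \<Omega> (L * dist p q) p q"
    by (rule bounded_C2_holder_domain_linked[OF assms(4)]) blast
  obtain Kg \<delta>2 where \<delta>2: "0 < \<delta>2"
    and Kg: "\<And>t q p. t \<in> {0<..T} \<Longrightarrow> q \<in> frontier \<Omega> \<Longrightarrow> p \<notin> \<Omega> \<Longrightarrow> dist p q < \<delta>2 \<Longrightarrow>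
      \<bar>g p t - g q t\<bar> \<le> Kg * dist p q powr \<alpha>"
    using assms(6) unfolding holder_at_boundary_def by blast
  obtain R where R: "0 < R"
    and supp: "\<And>\<epsilon> p q. 0 < \<epsilon> \<Longrightarrow> \<epsilon> \<le> 1 \<Longrightarrow> p \<in> \<Omega> \<Longrightarrow>
       rescaled_kernel J C1 \<epsilon> (heis_diff p q) \<noteq> 0 \<Longrightarrow> dist p q \<le> \<epsilon> * R"
    by (rule rescaled_kernel_support[OF J \<Omega>(2)]) blast
  define Q where "Q p t q = Dv p t \<bullet> (q - p) + D2v p t (q - p) \<bullet> (q - p) / 2" for p t q
  define KE where "KE = 9 * M * (3 * L) powr \<alpha> * L\<^sup>2"
  define KB where "KB = \<bar>Kg\<bar> + 3 * M"
  have KE0: "0 \<le> KE" using M0 by (simp add: KE_def)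
  have KB0: "0 \<le> KB" using M0 by (simp add: KB_def)
  have inside: "\<bar>v q t - (v p t + Q p t q)\<bar> \<le> KE * dist p q powr (2 + \<alpha>)"
    if "p \<in> \<Omega>" "q \<in> \<Omega>" "t \<in> {0..T}" "dist p q < \<delta>1" for p q t
    using holder_taylor_remainder[OF \<Omega>(1) Dv D2v D2v_cont D2v_holder M0 L0 \<alpha>(1) L[OF that(1,2,4)], of t] that
    by (simp add: Q_def KE_def add.assoc)
  have outside: "\<bar>g q t - (v p t + Q p t q)\<bar> \<le> KB * dist p q powr \<alpha>"
    if p: "p \<in> \<Omega>" and q: "q \<notin> \<Omega>" and t: "t \<in> {0<..T}" and d: "dist p q < \<delta>2" "dist p q \<le> 1" for p q t
  proof -
    have t': "t \<in> {0..T}" using t by auto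
    have vc: "continuous_on (closure \<Omega>) (\<lambda>x. v x t)"
      using continuous_on_compose2[OF v_cont, of "closure \<Omega>" "\<lambda>x. (x, t)"] t'
      by (force intro!: continuous_intros)
    obtain y where y: "y \<in> frontier \<Omega>" "dist q y \<le> dist p q" "\<bar>v y t - v p t\<bar> \<le> M * dist p q"
      by (rule segment_exit_estimate[OF \<Omega> Dv[OF _ t'] vc Dv_le[OF _ t'] p q])
    have le: "dist p q \<le> dist p q powr \<alpha>"
      using powr_mono'[of \<alpha> 1 "dist p q"] \<alpha> d by simp
    have "\<bar>g q t - g y t\<bar> \<le> Kg * dist q y powr \<alpha>" using Kg[OF t y(1) q] y(2) d by simp
    also have "\<dots> \<le> \<bar>Kg\<bar> * dist p q powr \<alpha>"
      using y(2) \<alpha> by (intro mult_mono powr_mono2) auto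
    finally have 1: "\<bar>g q t - v y t\<bar> \<le> \<bar>Kg\<bar> * dist p q powr \<alpha>" using v_bd[OF y(1) t] by simp
    have "\<bar>Dv p t \<bullet> (q - p)\<bar> \<le> M * dist p q"
      using Cauchy_Schwarz_ineq2[of "Dv p t" "q - p"] mult_right_mono[OF Dv_le[OF p t'], of "dist p q"]
      by (simp add: dist_norm norm_minus_commute)
    moreover have "\<bar>D2v p t (q - p) \<bullet> (q - p)\<bar> \<le> M * dist p q"
    proof -
      have "\<bar>D2v p t (q - p) \<bullet> (q - p)\<bar> \<le> norm (D2v p t (q - p)) * norm (q - p)"
        by (rule Cauchy_Schwarz_ineq2)
      also have "\<dots> \<le> (M * dist p q) * 1"
        using norm_blinfun[of "D2v p t" "q - p"] mult_right_mono[OF D2v_le[OF p t'], of "dist p q"] d M0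
        by (intro mult_mono) (auto simp: dist_norm norm_minus_commute)
      finally show ?thesis by simp
    qed
    ultimately have "\<bar>Q p t q\<bar> \<le> 2 * (M * dist p q)" unfolding Q_def by (simp add: abs_le_iff)
    then have "\<bar>g q t - (v p t + Q p t q)\<bar> \<le> \<bar>Kg\<bar> * dist p q powr \<alpha> + 3 * (M * dist p q)"
      using 1 y(3) by linarith
    also have "\<dots> \<le> KB * dist p q powr \<alpha>"
      using mult_left_mono[OF le M0] by (simp add: KB_def algebra_simps)
    finally show ?thesis .
  qed
  define C where "C = KB * R powr \<alpha> + (2 / C1 * (KE * R powr (2 + \<alpha>)) + M) * T"
  \<comment> \<open>For smaller \<open>\<epsilon>\<close> the kernel reaches at most as far as the local estimates do.\<close>
  define \<epsilon>0 where "\<epsilon>0 = min 1 (min (1 / R) (min (\<delta>1 / R) (\<delta>2 / R)))"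
  have \<epsilon>0: "0 < \<epsilon>0" using R \<delta>1 \<delta>2 by (simp add: \<epsilon>0_def)
  have main: "\<bar>u \<epsilon> p t - v p t\<bar> \<le> C * \<epsilon> powr \<alpha>"
    if \<epsilon>: "0 < \<epsilon>" "\<epsilon> < \<epsilon>0" and p: "p \<in> \<Omega>" and t: "t \<in> {0..T}" for \<epsilon> p t
  proof -
    have \<epsilon>R: "\<epsilon> < 1" "\<epsilon> * R < 1" "\<epsilon> * R < \<delta>1" "\<epsilon> * R < \<delta>2"
      using \<epsilon> R by (auto simp: \<epsilon>0_def field_simps)
    define E where "E = KE * (\<epsilon> * R) powr (2 + \<alpha>)"
    define B where "B = KB * (\<epsilon> * R) powr \<alpha>"
    have "\<bar>u \<epsilon> p t - v p t\<bar> \<le> B + (2 / C1 * E / \<epsilon>\<^sup>2 + \<epsilon>\<^sup>2 * M) * t"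
    proof (rule nonlocal_error_bound[OF J \<epsilon>(1) \<Omega> assms(8)[OF \<epsilon>(1)], where Dv = Dv and D2v = D2v])
      fix p q t assume pt: "p \<in> \<Omega>" "t \<in> {0<..T}"
        and K: "rescaled_kernel J C1 \<epsilon> (heis_diff p q) \<noteq> 0"
      have d: "dist p q \<le> \<epsilon> * R" using supp[OF \<epsilon>(1) _ pt(1) K] \<epsilon>R by simp
      {
        assume "q \<in> \<Omega>"
        then have "\<bar>v q t - (v p t + Q p t q)\<bar> \<le> KE * dist p q powr (2 + \<alpha>)"
          using pt d \<epsilon>R by (intro inside) auto
        also have "\<dots> \<le> E" unfolding E_def using d \<alpha> KE0 by (intro mult_left_mono powr_mono2) auto
        finally show "\<bar>v q t - (v p t + (Dv p t \<bullet> (q - p) + D2v p t (q - p) \<bullet> (q - p) / 2))\<bar> \<le> E"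
          by (simp add: Q_def)
      next
        assume "q \<notin> \<Omega>"
        then have "\<bar>g q t - (v p t + Q p t q)\<bar> \<le> KB * dist p q powr \<alpha>"
          using pt d \<epsilon>R by (intro outside) auto
        also have "\<dots> \<le> B" unfolding B_def using d \<alpha> KB0 by (intro mult_left_mono powr_mono2) auto
        finally show "\<bar>g q t - (v p t + (Dv p t \<bullet> (q - p) + D2v p t (q - p) \<bullet> (q - p) / 2))\<bar> \<le> B"
          by (simp add: Q_def)
      }
    next
      show "continuous_on {0..T} (v p)" if "p \<in> \<Omega>" for p
        using continuous_on_compose2[OF v_cont, of "{0..T}" "\<lambda>t. (p, t)"] that closure_subset
        by (force intro!: continuous_intros)
      show "0 \<le> E" "0 \<le> B" using KE0 KB0 by (simp_all add: E_def B_def)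
    qed (use continuous_on_compact_times_L1[OF \<Omega> v_cont] v_0 v_t Dv D2v D2v_le M0 p t in auto)
    also have "\<dots> \<le> KB * R powr \<alpha> * \<epsilon> powr \<alpha> + (2 / C1 * (KE * R powr (2 + \<alpha>)) * \<epsilon> powr \<alpha> + \<epsilon> powr \<alpha> * M) * T"
    proof (intro add_mono mult_mono)
      show "B \<le> KB * R powr \<alpha> * \<epsilon> powr \<alpha>"
        using \<epsilon> R by (simp add: B_def powr_mult mult_ac)
      have "(\<epsilon> * R) powr (2 + \<alpha>) = \<epsilon>\<^sup>2 * (\<epsilon> powr \<alpha> * R powr (2 + \<alpha>))"
        using \<epsilon> R by (simp add: powr_mult powr_add)
      then show "2 / C1 * E / \<epsilon>\<^sup>2 \<le> 2 / C1 * (KE * R powr (2 + \<alpha>)) * \<epsilon> powr \<alpha>"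
        using \<epsilon> by (simp add: E_def mult_ac)
      \<comment> \<open>The consistency error \<open>\<epsilon>\<^sup>2 \<partial>\<^sub>s\<^sup>2 v\<close> is of higher order than \<open>\<epsilon>\<^sup>\<alpha>\<close>.\<close>
      have "\<epsilon>\<^sup>2 = \<epsilon> powr 2" using \<epsilon> by simp
      also have "\<dots> \<le> \<epsilon> powr \<alpha>" using \<epsilon> \<epsilon>R \<alpha> by (intro powr_mono') auto
      finally show "\<epsilon>\<^sup>2 \<le> \<epsilon> powr \<alpha>" .
    qed (use C1 KE0 M0 t in auto)
    also have "\<dots> = C * \<epsilon> powr \<alpha>" by (simp add: C_def algebra_simps)
    finally show ?thesis .
  qed
  have "(SUP t\<in>{0..T}. esssup (lebesgue_on \<Omega>) (\<lambda>p. ereal \<bar>u \<epsilon> p t - v p t\<bar>)) \<le> ereal (C * \<epsilon> powr \<alpha>)"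
    if \<epsilon>: "0 < \<epsilon>" "\<epsilon> < \<epsilon>0" for \<epsilon>
  proof (intro SUP_least esssup_I)
    fix t assume t: "t \<in> {0..T}"
    have "integrable (lebesgue_on \<Omega>) (\<lambda>p. u \<epsilon> p t)"
      using assms(8)[OF \<epsilon>(1)] t by (simp add: nonlocal_solution_def)
    then have [measurable]: "(\<lambda>p. u \<epsilon> p t) \<in> borel_measurable (lebesgue_on \<Omega>)" by simp
    have [measurable]: "(\<lambda>p. v p t) \<in> borel_measurable (lebesgue_on \<Omega>)"
      using continuous_on_compact_times_L1(1)[OF \<Omega> v_cont t] by simp
    show "(\<lambda>p. ereal \<bar>u \<epsilon> p t - v p t\<bar>) \<in> borel_measurable (lebesgue_on \<Omega>)" by measurable
    show "AE p in lebesgue_on \<Omega>. ereal \<bar>u \<epsilon> p t - v p t\<bar> \<le> ereal (C * \<epsilon> powr \<alpha>)"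
      using main[OF \<epsilon> _ t] by (intro AE_I2) simp
  qed
  then show ?thesis
    using \<epsilon>0 by (intro exI[of _ C] eventually_at_rightI[of 0 \<epsilon>0]) auto
qed

end
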